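(* Let $A$ be a periodic locally compact abelian group and let $U$ be an open compact subgroup of $A$. The following statements are equivalent: (A) $A$ is strongly topologically quasihamiltonian. (B) There is a partition of $\pi(A)$ into four disjoint (possibly empty) subsets $\delta,\gamma,\phi,\mu$ such that all of the following hold: (i) $\delta=\{p\in\pi(A): A_p\cap U=\{0\}\}$ and $A_\delta$ is a discrete subgroup of $A$. (ii) $\gamma=\{p\in\pi(A): A_p\le U\}$ and $A_\gamma$ is a profinite subgroup of $A$. (iii) $\phi=\{p\in\pi(A)\setminus(\delta\cup\gamma): \mathrm{rank}_p(A_p)\ge 2\}$; the set $\phi$ is finite, and for all $p\in\phi$ the $p$-primary component $A_p$ is strongly topologically quasihamiltonian. (iv) $A_\mu$ is inductively monothetic. (v) $A=A_\delta\oplus A_\gamma\oplus A_\phi\oplus A_\mu$ topologically and algebraically.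
   Context: All topological groups are Hausdorff; abelian groups are written additively. A locally compact abelian (LCA) group is periodic if it is totally disconnected and the union of its compact subgroups. For a prime $p$, an element $x$ is a $p$-element if $p^kx\to 0$ as $k\to\infty$; in a periodic LCA group $A$ the $p$-elements form a closed subgroup $A_p$, the $p$-primary component ($p$-Sylow subgroup). $\pi(A)$ is the set of primes $p$ with $A_p\ne\{0\}$; for a set $\sigma$ of primes, $A_\sigma$ is the closed subgroup topologically generated by all $A_p$, $p\in\sigma$. A closed subgroup is finitely generated if it is the closure of the subgroup generated by a finite subset. $\mathrm{rank}_p(A_p)$ is the least $n$ such that every finitely generated closed subgroup of $A_p$ can be topologically generated by at most $n$ elements, and is infinite if no such $n$ exists. An LCA group is strongly topologically quasihamiltonian if $X+Y$ is closed for all closed subgroups $X,Y$. A periodic LCA group is inductively monothetic if every finitely generated closed subgroup can be topologically generated by a single element. *)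

theory Defs
  imports
    "HOL-Analysis.Analysis"
    "HOL-Computational_Algebra.Group_Closure"
    "HOL-Computational_Algebra.Primes"
    "HOL-Library.Extended_Nat"
begin

text \<open>
  The ambient Hausdorff abelian topological group is a type of sort
  \<open>{topological_ab_group_add, t2_space}\<close>; its subgroups are sets carrying the subspace topology.
  Locally compact subgroups of a Hausdorff group are closed, so for such a subgroup \<open>G\<close> the closed
  subsets and the closures taken inside \<open>G\<close> agree with those taken in the ambient type. The notions
  below with an argument \<open>G\<close> are meant for closed subgroups \<open>G\<close> and use this.
\<close>

definition add_subgroup :: "'a::ab_group_add set \<Rightarrow> bool" where
  "add_subgroup H \<longleftrightarrow>
     0 \<in> H \<and> (\<forall>x\<in>H. \<forall>y\<in>H. x + y \<in> H) \<and> (\<forall>x\<in>H. - x \<in> H)"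

definition closed_subgroup :: "'a::topological_ab_group_add set \<Rightarrow> bool" where
  "closed_subgroup H \<longleftrightarrow> add_subgroup H \<and> closed H"

definition totally_disconnected :: "'a::topological_space set \<Rightarrow> bool" where
  "totally_disconnected S \<longleftrightarrow> (\<forall>x\<in>S. connected_component_set S x = {x})"

definition lca_group :: "'a::{topological_ab_group_add, t2_space} set \<Rightarrow> bool" where
  "lca_group G \<longleftrightarrow> add_subgroup G \<and> locally_compact_space (top_of_set G)"

definition periodic_lca_group :: "'a::{topological_ab_group_add, t2_space} set \<Rightarrow> bool" where
  "periodic_lca_group G \<longleftrightarrow>
     lca_group G \<and> totally_disconnected G \<and>
     G = \<Union>{K. K \<subseteq> G \<and> add_subgroup K \<and> compact K}"

definition profinite_group :: "'a::{topological_ab_group_add, t2_space} set \<Rightarrow> bool" where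
  "profinite_group G \<longleftrightarrow> add_subgroup G \<and> compact G \<and> totally_disconnected G"

definition top_generated :: "'a::topological_ab_group_add set \<Rightarrow> 'a set" where
  "top_generated S = closure (group_closure S)"

definition top_finitely_generated :: "'a::topological_ab_group_add set \<Rightarrow> bool" where
  "top_finitely_generated H \<longleftrightarrow> (\<exists>F. finite F \<and> H = top_generated F)"

text \<open>The sum \<open>\<Sum>i<p ^ k. x\<close> is the multiple \<open>p\<^sup>k x\<close>.\<close>

definition primary_component :: "'a::topological_ab_group_add set \<Rightarrow> nat \<Rightarrow> 'a set" where
  "primary_component G p = {x \<in> G. (\<lambda>k. \<Sum>i<p ^ k. x) \<longlonglongrightarrow> 0}"

definition prime_support :: "'a::topological_ab_group_add set \<Rightarrow> nat set" where
  "prime_support G = {p. prime p \<and> primary_component G p \<noteq> {0}}"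

definition primary_part :: "'a::topological_ab_group_add set \<Rightarrow> nat set \<Rightarrow> 'a set" where
  "primary_part G \<sigma> = top_generated (\<Union>p\<in>\<sigma>. primary_component G p)"

text \<open>The infimum of the empty set in \<^typ>\<open>enat\<close> is \<open>\<infinity>\<close>.\<close>

definition top_rank :: "'a::topological_ab_group_add set \<Rightarrow> enat" where
  "top_rank G =
     Inf {enat n | n. \<forall>H. H \<subseteq> G \<and> closed_subgroup H \<and> top_finitely_generated H \<longrightarrow>
                        (\<exists>F. finite F \<and> card F \<le> n \<and> H = top_generated F)}"

definition strongly_top_quasihamiltonian :: "'a::topological_ab_group_add set \<Rightarrow> bool" where
  "strongly_top_quasihamiltonian G \<longleftrightarrow>
     (\<forall>X Y. X \<subseteq> G \<and> closed_subgroup X \<and> Y \<subseteq> G \<and> closed_subgroup Y \<longrightarrow>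
            closed {x + y | x y. x \<in> X \<and> y \<in> Y})"

definition inductively_monothetic :: "'a::topological_ab_group_add set \<Rightarrow> bool" where
  "inductively_monothetic G \<longleftrightarrow>
     (\<forall>H. H \<subseteq> G \<and> closed_subgroup H \<and> top_finitely_generated H \<longrightarrow>
          (\<exists>x. H = top_generated {x}))"

text \<open>Addition is always a homomorphism from the product, so the topological direct sum
  decomposition only requires it to be a homeomorphism.\<close>

definition top_direct_sum4 ::
  "'a::topological_ab_group_add set \<Rightarrow> 'a set \<Rightarrow> 'a set \<Rightarrow> 'a set \<Rightarrow> 'a set \<Rightarrow> bool" where
  "top_direct_sum4 G B C D E \<longleftrightarrow>
     add_subgroup B \<and> add_subgroup C \<and> add_subgroup D \<and> add_subgroup E \<and>
     homeomorphic_map (top_of_set (B \<times> C \<times> D \<times> E)) (top_of_set G)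
       (\<lambda>(b, c, d, e). b + c + d + e)"

end

(*
  Every element x of A splits along a set of primes: modulo an open subgroup its order factors into
  coprime parts, and compactness of the closed subgroup generated by x turns the splittings modulo
  all open subgroups into one honest splitting. This gives continuous projections onto the parts
  A_sigma that preserve every closed subgroup, so sums X + Y can be analysed prime by prime.

  On A_delta, A_gamma and A_mu sums of closed subgroups are closed because the group is discrete,
  compact, or has comparable closed subgroups at each prime. Conversely, at a prime of phi there are
  x outside U and v in U with p x in U such that v is not in the closed subgroup generated by p x;
  otherwise the cyclic closed subgroups of A_p would form a chain and the rank would be at most 1.
  Then v lies in the sum of the closed subgroups generated by x and by x + v, but not in the sum of
  their intersections with U, so infinitely many such primes produce closed subgroups X and Y whose
  sum is not closed.
*)

theory Submission
  imports Defs
begin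

section \<open>Integer multiples and closed subgroups\<close>

text \<open>The bad pair at a prime works as follows. An element of the procyclic group of x that
  lies in U already lies in that of p x, since anything outside the latter generates x; the same
  holds for x + v. If v were a sum of two such elements, it would lie in the closed subgroup of p x
  plus that of p v, and a topological Nakayama argument would remove the second summand, against the
  choice of v. At one prime this does no harm, as the two procyclic groups are compact and have a
  closed sum. Over infinitely many primes it does: every element of A has components in U at almost
  all primes, whereas compactness supplies one element whose components are all the prescribed v.

  Topology enters mostly through the open subgroups W. Orders modulo W turn convergence and
  closedness into Bezout arithmetic, and the procyclic subgroups at p behave like the ideals of the
  p-adic integers.\<close>

definition zmul :: "int \<Rightarrow> 'a::ab_group_add \<Rightarrow> 'a" where
  "zmul n x = (\<Sum>i<nat n. x) - (\<Sum>i<nat (- n). x)"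

lemma sum_const_add: "(\<Sum>i<a + b. x) = (\<Sum>i<a. x) + (\<Sum>i<b::nat. x::'a::ab_group_add)"
  by (induction b) (auto simp: algebra_simps)

lemma zmul_add_left: "zmul (k + l) x = zmul k x + zmul l (x::'a::ab_group_add)"
proof -
  \<comment> \<open>\<open>nat\<close> truncates at zero, so positive and negative parts are not
    additive separately; moving the negative parts across gives an identity of naturals valid for
    all signs.\<close>
  have "nat (k + l) + (nat (- k) + nat (- l)) = nat (- (k + l)) + (nat k + nat l)" by arith
  then have "(\<Sum>i<nat (k + l) + (nat (- k) + nat (- l)). x)
           = (\<Sum>i<nat (- (k + l)) + (nat k + nat l). x)" by presburger
  then show ?thesis
    unfolding zmul_def sum_const_add by (simp add: algebra_simps)
qed

lemma zmul_zero_left: "zmul 0 x = 0"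
  by (simp add: zmul_def)

lemma zmul_one: "zmul 1 x = x"
  by (simp add: zmul_def)

lemma zmul_zmul: "zmul k (zmul l x) = zmul (k * l) x"
proof (induction k rule: int_induct[where k = 0])
  case base
  show ?case by (simp add: zmul_zero_left)
next
  case (step1 i)
  then show ?case by (simp add: zmul_add_left zmul_one distrib_right)
next
  case (step2 i)
  then show ?case
    using zmul_add_left[of "i - 1" 1 "zmul l x"] zmul_add_left[of "(i - 1) * l" l x]
    by (simp add: zmul_one algebra_simps)
qed

text \<open>The integer module structure supplies the linear rewriting behind the Bezout
  computations.\<close>

interpretation zmul: module zmul
proof
  fix a b :: int and x y :: 'a
  show "zmul a (x + y) = zmul a x + zmul a y"
    by (simp add: zmul_def sum.distrib)
  show "zmul (a + b) x = zmul a x + zmul b x"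
    by (rule zmul_add_left)
  show "zmul a (zmul b x) = zmul (a * b) x"
    by (rule zmul_zmul)
  show "zmul 1 x = x"
    by (rule zmul_one)
qed

text \<open>Connects integer multiples with the sums by which \<open>primary_component\<close>
  expresses \<open>p^k x\<close>.\<close>

lemma zmul_of_nat: "zmul (int n) x = (\<Sum>i<n. x)"
  by (simp add: zmul_def)

lemma add_subgroup_0: "add_subgroup H \<Longrightarrow> 0 \<in> H"
  and add_subgroup_add: "add_subgroup H \<Longrightarrow> x \<in> H \<Longrightarrow> y \<in> H \<Longrightarrow> x + y \<in> H"
  and add_subgroup_minus: "add_subgroup H \<Longrightarrow> x \<in> H \<Longrightarrow> - x \<in> H"
  by (auto simp: add_subgroup_def)

lemma add_subgroup_diff: "add_subgroup H \<Longrightarrow> x \<in> H \<Longrightarrow> y \<in> H \<Longrightarrow> x - y \<in> H"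
  using add_subgroup_add[of H x "- y"] add_subgroup_minus by fastforce

lemma add_subgroup_sum: "add_subgroup H \<Longrightarrow> (\<And>i. i \<in> I \<Longrightarrow> f i \<in> H) \<Longrightarrow> sum f I \<in> H"
  by (induction I rule: infinite_finite_induct) (auto intro: add_subgroup_0 add_subgroup_add)

lemma add_subgroup_zmul: "add_subgroup H \<Longrightarrow> x \<in> H \<Longrightarrow> zmul n x \<in> H"
  unfolding zmul_def by (intro add_subgroup_diff add_subgroup_sum) auto

lemma add_subgroup_Int: "add_subgroup H \<Longrightarrow> add_subgroup K \<Longrightarrow> add_subgroup (H \<inter> K)"
  by (auto simp: add_subgroup_def)

lemma add_subgroup_Inter: "(\<And>W. W \<in> I \<Longrightarrow> add_subgroup W) \<Longrightarrow> add_subgroup (\<Inter>I)"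
  by (auto simp: add_subgroup_def)

lemma add_subgroup_trivial: "add_subgroup {0}"
  by (auto simp: add_subgroup_def)

lemma add_subgroup_add_cancel_left:
  assumes "add_subgroup H" "x \<in> H" shows "x + y \<in> H \<longleftrightarrow> y \<in> H"
  using assms add_subgroup_diff[of H "x + y" x] add_subgroup_add[of H x y] by auto

lemma add_subgroup_zmul_dvd:
  "add_subgroup H \<Longrightarrow> zmul m x \<in> H \<Longrightarrow> m dvd n \<Longrightarrow> zmul n x \<in> H"
  using add_subgroup_zmul[of H "zmul m x"] by (auto simp: mult.commute elim!: dvdE)

text \<open>Bezout: \<open>x = u (m x) + v (n x)\<close>. Orders modulo an open subgroup are
  compared through this.\<close>

lemma add_subgroup_zmul_coprime:
  assumes "add_subgroup H" "coprime m n" "zmul m x \<in> H" "zmul n x \<in> H"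
  shows "x \<in> H"
proof -
  obtain u v where uv: "u * m + v * n = 1"
    using bezout_int[of m n] coprime_imp_gcd_eq_1[OF assms(2)] by metis
  have "zmul u (zmul m x) + zmul v (zmul n x) \<in> H"
    using assms by (blast intro: add_subgroup_add add_subgroup_zmul)
  moreover have "zmul u (zmul m x) + zmul v (zmul n x) = x"
    using uv by (simp flip: zmul.scale_left_distrib)
  ultimately show ?thesis by simp
qed

definition set_sum :: "'a::plus set \<Rightarrow> 'a set \<Rightarrow> 'a set" where
  "set_sum X Y = {x + y | x y. x \<in> X \<and> y \<in> Y}"

lemma set_sum_eq_image: "set_sum X Y = (\<lambda>(x, y). x + y) ` (X \<times> Y)"
  by (auto simp: set_sum_def)

lemma add_subgroup_set_sum:
  assumes "add_subgroup H" "add_subgroup K" shows "add_subgroup (set_sum H K)"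
  unfolding add_subgroup_def
proof (intro conjI ballI)
  show "0 \<in> set_sum H K"
    using assms by (force simp: set_sum_def dest: add_subgroup_0)
next
  fix x y assume "x \<in> set_sum H K" "y \<in> set_sum H K"
  then obtain a b c d where "x = a + b" "y = c + d" "a \<in> H" "c \<in> H" "b \<in> K" "d \<in> K"
    by (auto simp: set_sum_def)
  then have "x + y = (a + c) + (b + d)" "a + c \<in> H" "b + d \<in> K"
    using assms by (auto simp: algebra_simps intro: add_subgroup_add)
  then show "x + y \<in> set_sum H K" by (auto simp: set_sum_def)
next
  fix x assume "x \<in> set_sum H K"
  then obtain a b where "x = a + b" "a \<in> H" "b \<in> K"
    by (auto simp: set_sum_def)
  then have "- x = - a + - b" "- a \<in> H" "- b \<in> K"
    using assms by (auto intro: add_subgroup_minus)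
  then show "- x \<in> set_sum H K" unfolding set_sum_def by blast
qed

lemma set_sum_superset:
  assumes "add_subgroup H" "add_subgroup K" shows "H \<subseteq> set_sum H K" "K \<subseteq> set_sum H K"
proof -
  have "0 \<in> H" "0 \<in> K" using assms by (auto intro: add_subgroup_0)
  then show "H \<subseteq> set_sum H K" "K \<subseteq> set_sum H K"
    unfolding set_sum_def by (force, metis (mono_tags, lifting) add_0 mem_Collect_eq subsetI)
qed

lemma set_sum_subset:
  "add_subgroup D \<Longrightarrow> H \<subseteq> D \<Longrightarrow> K \<subseteq> D \<Longrightarrow> set_sum H K \<subseteq> D"
  by (auto simp: set_sum_def intro!: add_subgroup_add)

lemma compact_set_sum:
  fixes X Y :: "'a::topological_ab_group_add set"
  assumes "compact X" "compact Y" shows "compact (set_sum X Y)"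
  unfolding set_sum_eq_image case_prod_beta
  by (intro compact_continuous_image compact_Times assms continuous_intros)

lemma continuous_on_zmul: "continuous_on S (zmul n :: 'a::topological_ab_group_add \<Rightarrow> 'a)"
  unfolding zmul_def by (intro continuous_intros)

lemma open_translation_add:
  fixes S :: "'a::topological_ab_group_add set"
  assumes "open S" shows "open {x. a + x \<in> S}"
  using open_vimage[OF assms, of "\<lambda>x. a + x"] by (simp add: vimage_def continuous_intros)

lemma open_subgroup_iff:
  fixes H :: "'a::topological_ab_group_add set"
  assumes "add_subgroup H" shows "open H \<longleftrightarrow> (\<exists>N. open N \<and> 0 \<in> N \<and> N \<subseteq> H)"
proof
  assume "\<exists>N. open N \<and> 0 \<in> N \<and> N \<subseteq> H"
  then obtain N where N: "open N" "0 \<in> N" "N \<subseteq> H" by blast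
  have "\<exists>T. open T \<and> x \<in> T \<and> T \<subseteq> H" if "x \<in> H" for x
  proof (intro exI conjI)
    show "open {y. - x + y \<in> N}" by (rule open_translation_add[OF N(1)])
    show "x \<in> {y. - x + y \<in> N}" using N by simp
    show "{y. - x + y \<in> N} \<subseteq> H"
      using N that add_subgroup_add_cancel_left[OF assms add_subgroup_minus[OF assms that]] by blast
  qed
  then show "open H" by (simp add: open_subopen[of H])
qed (use assms add_subgroup_0 in blast)

lemma open_subgroup_closed:
  fixes H :: "'a::topological_ab_group_add set"
  assumes "add_subgroup H" "open H" shows "closed H"
proof -
  have "\<exists>T. open T \<and> x \<in> T \<and> T \<subseteq> - H" if "x \<in> - H" for x
  proof (intro exI conjI)
    show "open {y. - x + y \<in> H}" by (rule open_translation_add[OF assms(2)])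
    show "x \<in> {y. - x + y \<in> H}" using assms by (simp add: add_subgroup_0)
    show "{y. - x + y \<in> H} \<subseteq> - H"
    proof clarsimp
      fix y assume "y - x \<in> H" "y \<in> H"
      then have "y - (y - x) \<in> H" using assms(1) by (blast intro: add_subgroup_diff)
      then show False using that by simp
    qed
  qed
  then show ?thesis unfolding closed_def by (simp add: open_subopen[of "- H"])
qed

lemma add_subgroup_closure:
  fixes H :: "'a::topological_ab_group_add set"
  assumes "add_subgroup H" shows "add_subgroup (closure H)"
  unfolding add_subgroup_def
proof (intro conjI ballI)
  show "0 \<in> closure H" using assms closure_subset add_subgroup_0 by blast
next
  have "(\<lambda>(x, y). x + y) ` closure (H \<times> H) \<subseteq> closure H"
    by (rule image_closure_subset)
       (use assms closure_subset in \<open>auto simp: case_prod_beta intro!: continuous_intros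
         subsetD[OF closure_subset] add_subgroup_add\<close>)
  then show "x + y \<in> closure H" if "x \<in> closure H" "y \<in> closure H" for x y
    using that by (auto simp: closure_Times)
next
  have "uminus ` closure H \<subseteq> closure H"
    by (rule image_closure_subset)
       (use assms closure_subset in \<open>auto intro!: continuous_intros
         subsetD[OF closure_subset] add_subgroup_minus\<close>)
  then show "- x \<in> closure H" if "x \<in> closure H" for x
    using that by auto
qed

lemma add_subgroup_group_closure: "add_subgroup (group_closure S)"
  by (auto simp: add_subgroup_def intro: group_closure_add)

lemma group_closure_minimal: "add_subgroup H \<Longrightarrow> S \<subseteq> H \<Longrightarrow> group_closure S \<subseteq> H"
proof
  fix x assume "add_subgroup H" "S \<subseteq> H" "x \<in> group_closure S"
  from this(3,1,2) show "x \<in> H"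
    by (induction rule: group_closure.induct) (auto intro: add_subgroup_0 add_subgroup_diff)
qed

lemma closed_subgroup_top_generated: "closed_subgroup (top_generated S)"
  by (simp add: closed_subgroup_def top_generated_def add_subgroup_closure add_subgroup_group_closure)

lemma add_subgroup_top_generated: "add_subgroup (top_generated S)"
  and closed_top_generated: "closed (top_generated S)"
  using closed_subgroup_top_generated[of S] by (auto simp: closed_subgroup_def)

lemma top_generated_superset: "S \<subseteq> top_generated S"
  unfolding top_generated_def using closure_subset by (fastforce intro: group_closure.base)

lemma top_generated_minimal: "closed_subgroup H \<Longrightarrow> S \<subseteq> H \<Longrightarrow> top_generated S \<subseteq> H"
  unfolding top_generated_def closed_subgroup_def
  by (intro closure_minimal group_closure_minimal) auto

lemma top_generated_mono: "S \<subseteq> T \<Longrightarrow> top_generated S \<subseteq> top_generated T"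
  by (meson closed_subgroup_top_generated order_trans top_generated_minimal top_generated_superset)

lemma top_finitely_generated_top_generated: "finite F \<Longrightarrow> top_finitely_generated (top_generated F)"
  unfolding top_finitely_generated_def by (rule exI[of _ F]) simp

lemma mem_top_generated_self: "x \<in> top_generated {x}"
  using top_generated_superset by blast

lemma top_generated_closed_subgroup: "closed_subgroup H \<Longrightarrow> top_generated H = H"
  by (simp add: subset_antisym top_generated_minimal top_generated_superset)

lemma closed_subgroup_Int:
  "closed_subgroup H \<Longrightarrow> closed_subgroup K \<Longrightarrow> closed_subgroup (H \<inter> K)"
  by (auto simp: closed_subgroup_def add_subgroup_Int)

lemma closed_subgroup_trivial: "closed_subgroup {0::'a::{topological_ab_group_add, t2_space}}"
  by (simp add: closed_subgroup_def add_subgroup_trivial)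

lemma compact_subgroup_closed:
  "compact H \<Longrightarrow> add_subgroup H \<Longrightarrow> closed_subgroup (H :: 'a::{topological_ab_group_add, t2_space} set)"
  by (simp add: closed_subgroup_def compact_imp_closed)

lemma open_subgroup_closed_subgroup:
  "add_subgroup H \<Longrightarrow> open H \<Longrightarrow> closed_subgroup (H :: 'a::topological_ab_group_add set)"
  by (simp add: closed_subgroup_def open_subgroup_closed)

lemma additive_image_subgroup:
  assumes "Modules.additive f" "add_subgroup H" shows "add_subgroup (f ` H)"
proof -
  interpret Modules.additive f by fact
  show ?thesis
    unfolding add_subgroup_def
  proof (intro conjI ballI)
    show "0 \<in> f ` H" using imageI[OF add_subgroup_0[OF assms(2)], of f] by (simp add: zero)
  next
    fix x y assume "x \<in> f ` H" "y \<in> f ` H"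
    then obtain a b where "a \<in> H" "b \<in> H" "x = f a" "y = f b" by blast
    then show "x + y \<in> f ` H"
      using imageI[OF add_subgroup_add[OF assms(2)], of a b f] by (simp add: add)
  next
    fix x assume "x \<in> f ` H"
    then obtain a where "a \<in> H" "x = f a" by blast
    then show "- x \<in> f ` H"
      using imageI[OF add_subgroup_minus[OF assms(2)], of a f] by (simp add: minus)
  qed
qed

lemma additive_vimage_closed_subgroup:
  fixes f :: "'a::topological_ab_group_add \<Rightarrow> 'b::topological_ab_group_add"
  assumes "Modules.additive f" "continuous_on UNIV f" "closed_subgroup H"
  shows "closed_subgroup (f -` H)"
  unfolding closed_subgroup_def
proof
  interpret Modules.additive f by fact
  show "add_subgroup (f -` H)"
    using assms(3) by (auto simp: closed_subgroup_def add_subgroup_def add minus zero)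
  show "closed (f -` H)"
    using assms by (auto simp: closed_subgroup_def intro: closed_vimage)
qed

lemma additive_top_generated_image:
  fixes f :: "'a::topological_ab_group_add \<Rightarrow> 'b::topological_ab_group_add"
  assumes "Modules.additive f" "continuous_on UNIV f"
  shows "f ` top_generated S \<subseteq> top_generated (f ` S)"
proof -
  have "top_generated S \<subseteq> f -` top_generated (f ` S)"
    using top_generated_superset[of "f ` S"]
    by (intro top_generated_minimal additive_vimage_closed_subgroup[OF assms]
        closed_subgroup_top_generated) auto
  then show ?thesis by blast
qed

lemma additive_zmul: "Modules.additive (zmul n)"
  by (rule Modules.additive.intro) (rule zmul.scale_right_distrib)

lemma top_generated_insert_subset:
  "x \<in> top_generated S \<Longrightarrow> top_generated (insert x S) = top_generated S"
  by (intro subset_antisym top_generated_mono top_generated_minimal closed_subgroup_top_generated)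
     (use top_generated_superset in auto)

lemma top_generated_insert_cong:
  assumes "top_generated S = top_generated T"
  shows "top_generated (insert x S) = top_generated (insert x T)"
proof -
  have "top_generated (insert x S) \<subseteq> top_generated (insert x T)"
    if "top_generated S = top_generated T" for S T :: "'a set"
    by (rule top_generated_minimal[OF closed_subgroup_top_generated])
       (use that top_generated_superset[of "insert x T"] top_generated_superset[of S]
         top_generated_mono[of T "insert x T"] in auto)
  from this[OF assms] this[OF assms[symmetric]] show ?thesis by blast
qed

text \<open>Strips one prime at a time and sorts it into one of the factors. In
  \<open>ex_sigma_split_mod\<close> this is applied to a multiplier taking an element into an open
  subgroup.\<close>

lemma ex_prime_set_factorization:
  fixes m :: nat assumes "m > 0"
  shows "\<exists>a b. m = a * b \<and> (\<forall>q. prime q \<and> q dvd a \<longrightarrow> q \<in> \<sigma>) \<and> (\<forall>q. prime q \<and> q dvd b \<longrightarrow> q \<notin> \<sigma>)"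
  using assms
proof (induction m rule: less_induct)
  case (less m)
  show ?case
  proof (cases "m = 1")
    case True
    then show ?thesis by (intro exI[of _ 1]) auto
  next
    case False
    then obtain p where p: "prime p" "p dvd m" using prime_factor_nat by blast
    then obtain k where k: "m = p * k" by blast
    have "k < m" "k > 0" using k less.prems p prime_gt_1_nat[OF p(1)] by auto
    then obtain a b where ab: "k = a * b" "\<forall>q. prime q \<and> q dvd a \<longrightarrow> q \<in> \<sigma>" "\<forall>q. prime q \<and> q dvd b \<longrightarrow> q \<notin> \<sigma>"
      using less.IH by blast
    have pq: "q dvd p \<longleftrightarrow> q = p" if "prime q" for q
      using that p(1) primes_dvd_imp_eq by auto
    show ?thesis
    proof (cases "p \<in> \<sigma>")
      case True
      then show ?thesis
        using k ab by - (rule exI[of _ "p * a"], rule exI[of _ b], auto simp: prime_dvd_mult_iff pq)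
    next
      case False
      then show ?thesis
        using k ab by - (rule exI[of _ a], rule exI[of _ "p * b"], auto simp: prime_dvd_mult_iff pq)
    qed
  qed
qed

lemma coprime_if_no_common_prime:
  fixes m n :: nat
  assumes "\<And>q. prime q \<Longrightarrow> q dvd m \<Longrightarrow> q dvd n \<Longrightarrow> False"
  shows "coprime m n"
  using assms prime_factor_nat[of "gcd m n"] by (auto simp: coprime_iff_gcd_eq_1)

section \<open>Periodic groups and their projections\<close>

text \<open>The group is the whole type, and its local compactness is carried by the open compact
  subgroup \<open>U\<close>. Periodicity is stated elementwise, the form in which it is
  applied.\<close>

locale periodic_group =
  fixes U :: "'a::{topological_ab_group_add, t2_space} set"
  assumes subgroup_U: "add_subgroup U"
    and open_U: "open U"
    and compact_U: "compact U"
    and totally_disconnected_UNIV: "totally_disconnected (UNIV :: 'a set)"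
    and mem_compact_subgroup: "\<exists>K. add_subgroup K \<and> compact K \<and> (x::'a) \<in> K"
begin

section \<open>Open subgroups as a base of neighbourhoods (van Dantzig)\<close>

lemma clopen_base_0:
  assumes "open (S :: 'a set)" "0 \<in> S"
  obtains C where "open C" "compact C" "0 \<in> C" "C \<subseteq> S"
proof -
  let ?X = "top_of_set U"
  have U0: "0 \<in> U" using subgroup_U by (rule add_subgroup_0)
  \<comment> \<open>Trivial components alone do not give small clopen sets, but a compact component
    of a locally compact Hausdorff space has them inside every neighbourhood. The component is
    computed in the compact space \<open>U\<close>, whose relatively open sets are open in the
    group.\<close>
  have "connected_component_of_set ?X 0 = {0}"
  proof
    show "connected_component_of_set ?X 0 \<subseteq> {0}"
    proof
      fix y assume "y \<in> connected_component_of_set ?X 0"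
      then obtain T where "connected T" "0 \<in> T" "y \<in> T"
        by (auto simp: connected_component_of_def connectedin_subtopology)
      then have "y \<in> connected_component_set UNIV 0"
        by (auto simp: connected_component_def)
      then show "y \<in> {0}"
        using totally_disconnected_UNIV by (auto simp: totally_disconnected_def)
    qed
  qed (use U0 in \<open>auto simp: connected_component_of_refl\<close>)
  then have comp: "{0} \<in> connected_components_of ?X"
    using U0 by (force simp: connected_components_of_def)
  have "compact_space ?X"
    using compact_U by (simp add: compact_space_subtopology)
  then have lc: "locally_compact_space ?X"
    by (simp add: compact_imp_locally_compact_space)
  have hd: "Hausdorff_space ?X"
    by (rule Hausdorff_space_subtopology)
       (simp add: Hausdorff_space_def disjnt_def, metis hausdorff)
  have "openin ?X (S \<inter> U)" "{0} \<subseteq> S \<inter> U"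
    using assms U0 open_U by (auto simp: openin_open)
  then obtain C V where C: "openin ?X C" "openin ?X V" "disjnt C V" "C \<union> V = topspace ?X" "{0} \<subseteq> C" "C \<subseteq> S \<inter> U"
    using wilder_locally_compact_component_thm[OF lc hd comp] by (metis compactin_sing U0 topspace_euclidean_subtopology)
  show ?thesis
  proof
    show "open C" using C(1) open_U by (meson openin_open_trans)
    have "open V" using C(2) open_U by (meson openin_open_trans)
    moreover have "C = U - V" using C by (auto simp: disjnt_def)
    ultimately show "compact C" using compact_U by (simp add: compact_diff)
  qed (use C in auto)
qed

text \<open>The stabiliser of a compact open neighbourhood of \<open>0\<close> is an open subgroup inside it.\<close>

lemma open_subgroup_base:
  assumes "open (S :: 'a set)" "0 \<in> S"
  obtains W where "add_subgroup W" "open W" "W \<subseteq> S"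
proof -
  obtain C where C: "open C" "compact C" "0 \<in> C" "C \<subseteq> S"
    using clopen_base_0[OF assms] .
  define W where "W = {g. (\<forall>c\<in>C. g + c \<in> C) \<and> (\<forall>c\<in>C. - g + c \<in> C)}"
  have sub: "add_subgroup W"
    unfolding add_subgroup_def
  proof (intro conjI ballI)
    show "0 \<in> W" by (simp add: W_def)
  next
    fix g h assume gh: "g \<in> W" "h \<in> W"
    have "g + h + c \<in> C \<and> - (g + h) + c \<in> C" if "c \<in> C" for c
    proof -
      have "g + (h + c) \<in> C" "- g + (- h + c) \<in> C"
        using gh that unfolding W_def by blast+
      moreover have "- (g + h) + c = - g + (- h + c)" "g + h + c = g + (h + c)"
        by (simp_all add: add.assoc)
      ultimately show ?thesis by (simp only:)
    qed
    then show "g + h \<in> W" unfolding W_def by blast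
  qed (auto simp: W_def add.commute)
  \<comment> \<open>Tube argument: continuity of addition at each \<open>(0, c)\<close> and
    compactness of \<open>C\<close> give one neighbourhood of 0 that moves all of \<open>C\<close>
    into \<open>C\<close>.\<close>
  have "\<exists>N. open N \<and> 0 \<in> N \<and> (\<forall>g\<in>N. \<forall>c\<in>C. g + c \<in> C)"
  proof -
    have "\<exists>N M. open N \<and> open M \<and> 0 \<in> N \<and> c \<in> M \<and> (\<forall>g\<in>N. \<forall>m\<in>M. g + m \<in> C)" if "c \<in> C" for c
    proof -
      have "open ((\<lambda>(x, y). x + y) -` C)"
        by (rule open_vimage[OF C(1)]) (auto simp: case_prod_beta intro!: continuous_intros)
      moreover have "(0, c) \<in> (\<lambda>(x, y). x + y) -` C" using that by simp
      ultimately obtain N M where "open N" "open M" "(0, c) \<in> N \<times> M" "N \<times> M \<subseteq> (\<lambda>(x, y). x + y) -` C"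
        by (metis open_prod_elim)
      then show ?thesis by (intro exI[of _ N] exI[of _ M]) auto
    qed
    then obtain N M where NM: "\<And>c. c \<in> C \<Longrightarrow> open (N c) \<and> open (M c) \<and> 0 \<in> N c \<and> c \<in> M c \<and> (\<forall>g\<in>N c. \<forall>m\<in>M c. g + m \<in> C)"
      by metis
    obtain F where F: "F \<subseteq> C" "finite F" "C \<subseteq> (\<Union>c\<in>F. M c)"
      using compactE_image[OF C(2), of C M] NM by blast
    have "g + c \<in> C" if gc: "g \<in> (\<Inter>c\<in>F. N c)" "c \<in> C" for g c
    proof -
      obtain d where "d \<in> F" "c \<in> M d" using F gc by blast
      then show ?thesis using NM[of d] F gc by blast
    qed
    moreover have "open (\<Inter>c\<in>F. N c)" using F NM by (intro open_INT) auto
    moreover have "0 \<in> (\<Inter>c\<in>F. N c)" using F NM by auto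
    ultimately show ?thesis by blast
  qed
  then obtain N where N: "open N" "0 \<in> N" "\<And>g c. g \<in> N \<Longrightarrow> c \<in> C \<Longrightarrow> g + c \<in> C" by blast
  \<comment> \<open>Membership in \<open>W\<close> asks that both \<open>g\<close> and
    \<open>- g\<close> preserve \<open>C\<close>, so the neighbourhood is made symmetric.\<close>
  have "open (N \<inter> uminus -` N)"
    using N(1) by (intro open_Int open_vimage) (auto intro!: continuous_intros)
  moreover have "0 \<in> N \<inter> uminus -` N" using N by simp
  moreover have "N \<inter> uminus -` N \<subseteq> W" unfolding W_def using N(3) by blast
  ultimately have "open W" using open_subgroup_iff[OF sub] by blast
  moreover have "W \<subseteq> S" using C by (force simp: W_def)
  ultimately show ?thesis using sub that by blast
qed

lemma coset_in_open:
  assumes "open (S :: 'a set)" "x \<in> S"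
  obtains W where "add_subgroup W" "open W" "\<And>y. y - x \<in> W \<Longrightarrow> y \<in> S"
proof -
  obtain W where W: "add_subgroup W" "open W" "W \<subseteq> {w. x + w \<in> S}"
    using open_subgroup_base[of "{w. x + w \<in> S}"] open_translation_add[OF assms(1), of x] assms by auto
  have "y \<in> S" if "y - x \<in> W" for y
    using W(3) that by force
  then show ?thesis using W that by blast
qed

text \<open>Cosets of open subgroups form a base of the topology, so closedness becomes an algebraic
  test.\<close>

lemma closed_iff_cosets:
  "closed (S :: 'a set) \<longleftrightarrow> (\<forall>x. (\<forall>W. add_subgroup W \<and> open W \<longrightarrow> (\<exists>y\<in>S. y - x \<in> W)) \<longrightarrow> x \<in> S)"
  (is "_ \<longleftrightarrow> ?R")
proof
  assume "closed S"
  show ?R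
  proof (intro allI impI, rule ccontr)
    fix x assume *: "\<forall>W. add_subgroup W \<and> open W \<longrightarrow> (\<exists>y\<in>S. y - x \<in> W)" and "x \<notin> S"
    then have "open (- S)" "x \<in> - S" using \<open>closed S\<close> by auto
    then obtain W where W: "add_subgroup W" "open W" "\<And>y. y - x \<in> W \<Longrightarrow> y \<in> - S"
      by (rule coset_in_open) blast
    then obtain y where "y \<in> S" "y - x \<in> W" using * by blast
    then show False using W(3) by blast
  qed
next
  assume R: ?R
  have "\<exists>T. open T \<and> x \<in> T \<and> T \<subseteq> - S" if "x \<in> - S" for x
  proof -
    have "\<not> (\<forall>W. add_subgroup W \<and> open W \<longrightarrow> (\<exists>y\<in>S. y - x \<in> W))"
      using spec[OF R, of x] that by simp
    then obtain W where W: "add_subgroup W" "open W" "\<forall>y\<in>S. y - x \<notin> W"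
      by metis
    then have "open {y. - x + y \<in> W}" by (simp only: open_translation_add)
    then show ?thesis using W by (intro exI[of _ "{y. - x + y \<in> W}"]) (auto simp: add_subgroup_0)
  qed
  then show "closed S" unfolding closed_def by (simp add: open_subopen[of "- S"])
qed

text \<open>Meeting every coset \<open>x + W\<close> puts \<open>x\<close> in the closure of
  \<open>D\<close>, so membership may be checked modulo each open subgroup.\<close>

lemma closed_subgroup_memI:
  assumes "closed_subgroup (D :: 'a set)"
    and "\<And>W. add_subgroup W \<Longrightarrow> open W \<Longrightarrow> x \<in> set_sum D W"
  shows "x \<in> D"
proof -
  have "\<exists>y\<in>D. y - x \<in> W" if W: "add_subgroup W" "open W" for W
  proof -
    obtain d w where "x = d + w" "d \<in> D" "w \<in> W"
      using assms(2)[OF W] by (auto simp: set_sum_def)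
    then show ?thesis using add_subgroup_minus[OF W(1)] by (intro bexI[of _ d]) auto
  qed
  then show ?thesis using assms(1) closed_iff_cosets[of D] by (auto simp: closed_subgroup_def)
qed

lemma eq_0_if_in_open_subgroups:
  assumes "\<And>W. add_subgroup W \<Longrightarrow> open W \<Longrightarrow> x \<in> W"
  shows "x = (0::'a)"
proof -
  have "x \<in> {0}"
    by (rule closed_subgroup_memI[OF closed_subgroup_trivial])
       (use assms in \<open>auto simp: set_sum_def\<close>)
  then show ?thesis by simp
qed

text \<open>Periodicity enters here: a compact subgroup containing \<open>x\<close> meets only
  finitely many cosets of \<open>W\<close>, so two multiples of \<open>x\<close> share a coset, and
  their difference is the multiple sought.\<close>

lemma ex_multiple_in_open_subgroup:
  fixes x :: 'a
  assumes W: "add_subgroup W" "open W"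
  obtains m where "m > 0" "zmul (int m) x \<in> W"
proof -
  obtain K where K: "add_subgroup K" "compact K" "x \<in> K"
    using mem_compact_subgroup by blast
  have "open {y. - k + y \<in> W}" for k by (rule open_translation_add[OF W(2)])
  moreover have "K \<subseteq> (\<Union>k\<in>K. {y. - k + y \<in> W})" using add_subgroup_0[OF W(1)] by auto
  ultimately obtain F where F: "F \<subseteq> K" "finite F" "K \<subseteq> (\<Union>k\<in>F. {y. - k + y \<in> W})"
    using compactE_image[OF K(2), of K "\<lambda>k. {y. - k + y \<in> W}"] by blast
  have "\<exists>k\<in>F. - k + zmul (int n) x \<in> W" for n
    using F(3) add_subgroup_zmul[OF K(1,3), of "int n"] by blast
  then obtain f where f: "\<And>n. f n \<in> F" "\<And>n. - f n + zmul (int n) x \<in> W" by metis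
  have "\<not> inj f"
    using F(2) f(1) by (meson finite_subset image_subsetI infinite_UNIV_nat inj_on_finite)
  then obtain i j where ij: "i < j" "f i = f j"
    unfolding inj_def by (metis linorder_neqE_nat)
  have "(- f j + zmul (int j) x) - (- f i + zmul (int i) x) \<in> W"
    by (rule add_subgroup_diff[OF W(1) f(2) f(2)])
  then have "zmul (int (j - i)) x \<in> W"
    using ij by (simp add: of_nat_diff zmul.scale_left_diff_distrib)
  then show ?thesis using that[of "j - i"] ij by simp
qed

text \<open>Each new generator lies in a compact subgroup, and the sum of two compact subgroups is
  compact, hence closed.\<close>

lemma compact_top_generated:
  assumes "finite (F :: 'a set)" shows "compact (top_generated F)"
  using assms
proof (induction F)
  case empty
  show ?case by (simp add: top_generated_def)
next
  case (insert x F)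
  obtain K where K: "add_subgroup K" "compact K" "x \<in> K"
    using mem_compact_subgroup by blast
  let ?S = "set_sum K (top_generated F)"
  have "add_subgroup ?S" "compact ?S"
    by (simp_all add: K insert.IH add_subgroup_set_sum compact_set_sum add_subgroup_top_generated)
  then have "closed_subgroup ?S" by (simp add: compact_subgroup_closed)
  moreover have "insert x F \<subseteq> ?S"
    using set_sum_superset[OF K(1) add_subgroup_top_generated[of F]] K(3) top_generated_superset[of F] by blast
  ultimately have "top_generated (insert x F) \<subseteq> ?S" by (rule top_generated_minimal)
  then show ?case
    using \<open>compact ?S\<close> closed_top_generated by (metis compact_Int_closed inf.absorb2)
qed

section \<open>Elements of \<sigma>-order modulo every open subgroup\<close>

definition sigma_order_in :: "nat set \<Rightarrow> 'a set \<Rightarrow> 'a \<Rightarrow> bool" where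
  "sigma_order_in \<sigma> W x \<longleftrightarrow> (\<exists>m>0. (\<forall>q. prime q \<and> q dvd m \<longrightarrow> q \<in> \<sigma>) \<and> zmul (int m) x \<in> W)"

text \<open>This turns out to be the part of the group at \<sigma> (\<open>primary_part_eq\<close>).
  Testing the order modulo each open subgroup makes it an elementwise condition without closures or
  limits, open to divisibility arguments.\<close>

definition sigma_elements :: "nat set \<Rightarrow> 'a set" where
  "sigma_elements \<sigma> = {x. \<forall>W. add_subgroup W \<and> open W \<longrightarrow> sigma_order_in \<sigma> W x}"

lemma sigma_elements_iff:
  "x \<in> sigma_elements \<sigma> \<longleftrightarrow> (\<forall>W. add_subgroup W \<and> open W \<longrightarrow> sigma_order_in \<sigma> W x)"
  by (simp add: sigma_elements_def)

lemma sigma_elementsE: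
  assumes "x \<in> sigma_elements \<sigma>" "add_subgroup W" "open W"
  obtains m where "m > 0" "\<And>q. prime q \<Longrightarrow> q dvd m \<Longrightarrow> q \<in> \<sigma>" "zmul (int m) x \<in> W"
  using assms unfolding sigma_elements_def sigma_order_in_def by blast

lemma sigma_elements_mono: "\<sigma> \<subseteq> \<tau> \<Longrightarrow> sigma_elements \<sigma> \<subseteq> sigma_elements \<tau>"
  unfolding sigma_elements_def sigma_order_in_def by blast

lemma sigma_elements_UNIV: "sigma_elements UNIV = UNIV"
proof -
  have "\<exists>m>0. zmul (int m) x \<in> W" if "add_subgroup W" "open W" for x :: 'a and W
    using ex_multiple_in_open_subgroup[OF that] by blast
  then show ?thesis by (simp add: sigma_elements_def sigma_order_in_def)
qed

lemma closed_subgroup_sigma_elements: "closed_subgroup (sigma_elements \<sigma>)"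
  unfolding closed_subgroup_def
proof
  show "add_subgroup (sigma_elements \<sigma>)"
    unfolding add_subgroup_def
  proof (intro conjI ballI)
    show "0 \<in> sigma_elements \<sigma>"
      unfolding sigma_elements_def sigma_order_in_def by (auto intro!: exI[of _ "1::nat"] simp: add_subgroup_0)
  next
    fix x y assume xy: "x \<in> sigma_elements \<sigma>" "y \<in> sigma_elements \<sigma>"
    show "x + y \<in> sigma_elements \<sigma>"
      unfolding sigma_elements_def sigma_order_in_def
    proof (clarify)
      fix W :: "'a set" assume W: "add_subgroup W" "open W"
      obtain m where m: "m > 0" "\<And>q. prime q \<Longrightarrow> q dvd m \<Longrightarrow> q \<in> \<sigma>" "zmul (int m) x \<in> W"
        using sigma_elementsE[OF xy(1) W] by blast
      obtain n where n: "n > 0" "\<And>q. prime q \<Longrightarrow> q dvd n \<Longrightarrow> q \<in> \<sigma>" "zmul (int n) y \<in> W"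
        using sigma_elementsE[OF xy(2) W] by blast
      have "zmul (int (m * n)) (x + y) \<in> W"
        unfolding zmul.scale_right_distrib
        by (rule add_subgroup_add[OF W(1) add_subgroup_zmul_dvd[OF W(1) m(3)]
            add_subgroup_zmul_dvd[OF W(1) n(3)]]) simp_all
      then show "\<exists>m>0. (\<forall>q. prime q \<and> q dvd m \<longrightarrow> q \<in> \<sigma>) \<and> zmul (int m) (x + y) \<in> W"
        using m n by (intro exI[of _ "m * n"]) (auto simp: prime_dvd_mult_iff)
    qed
  next
    fix x assume "x \<in> sigma_elements \<sigma>"
    then show "- x \<in> sigma_elements \<sigma>"
      unfolding sigma_elements_def sigma_order_in_def by (simp add: zmul.scale_minus_right) (metis add_subgroup_minus)
  qed
  show "closed (sigma_elements \<sigma>)"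
    unfolding closed_iff_cosets
  proof (intro allI impI)
    fix x assume *: "\<forall>W. add_subgroup W \<and> open W \<longrightarrow> (\<exists>y\<in>sigma_elements \<sigma>. y - x \<in> W)"
    show "x \<in> sigma_elements \<sigma>"
      unfolding sigma_elements_def sigma_order_in_def
    proof (clarify)
      fix W :: "'a set" assume W: "add_subgroup W" "open W"
      then obtain y where y: "y \<in> sigma_elements \<sigma>" "y - x \<in> W" using * by blast
      obtain m where m: "m > 0" "\<And>q. prime q \<Longrightarrow> q dvd m \<Longrightarrow> q \<in> \<sigma>" "zmul (int m) y \<in> W"
        using sigma_elementsE[OF y(1) W] by blast
      have "zmul (int m) y - zmul (int m) (y - x) \<in> W"
        using m y by (blast intro: add_subgroup_diff[OF W(1)] add_subgroup_zmul[OF W(1)])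
      then show "\<exists>m>0. (\<forall>q. prime q \<and> q dvd m \<longrightarrow> q \<in> \<sigma>) \<and> zmul (int m) x \<in> W"
        using m by (intro exI[of _ m]) (auto simp: zmul.scale_right_diff_distrib)
    qed
  qed
qed

lemma add_subgroup_sigma_elements: "add_subgroup (sigma_elements \<sigma>)"
  using closed_subgroup_sigma_elements by (simp add: closed_subgroup_def)

text \<open>Coprime multipliers put \<open>x\<close> into every open subgroup, and these intersect
  in 0.\<close>

lemma sigma_elements_disjoint:
  assumes "x \<in> sigma_elements \<sigma>" "x \<in> sigma_elements \<tau>" "\<sigma> \<inter> \<tau> = {}"
  shows "x = 0"
proof (rule eq_0_if_in_open_subgroups)
  fix W :: "'a set" assume W: "add_subgroup W" "open W"
  obtain m where m: "m > 0" "\<And>q. prime q \<Longrightarrow> q dvd m \<Longrightarrow> q \<in> \<sigma>" "zmul (int m) x \<in> W"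
    using sigma_elementsE[OF assms(1) W] by blast
  obtain n where n: "n > 0" "\<And>q. prime q \<Longrightarrow> q dvd n \<Longrightarrow> q \<in> \<tau>" "zmul (int n) x \<in> W"
    using sigma_elementsE[OF assms(2) W] by blast
  have "coprime m n"
    using m(2) n(2) assms(3) prime_factor_nat[of "gcd m n"] by (auto simp: coprime_iff_gcd_eq_1)
  then have "coprime (int m) (int n)" by simp
  then show "x \<in> W" using add_subgroup_zmul_coprime[OF W(1)] m n by blast
qed

text \<open>Makes the sets of splittings modulo \<open>W\<close> in \<open>ex_sigma_split\<close>
  unions of cosets of \<open>W\<close>, and therefore closed.\<close>

lemma sigma_order_in_cong:
  assumes "add_subgroup W" "y - x \<in> W" shows "sigma_order_in \<sigma> W x \<longleftrightarrow> sigma_order_in \<sigma> W y"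
proof -
  have "zmul (int m) x \<in> W \<longleftrightarrow> zmul (int m) y \<in> W" for m
    using add_subgroup_add_cancel_left[OF assms(1) add_subgroup_zmul[OF assms, of "int m"], of "zmul (int m) x"]
    by (simp add: zmul.scale_right_diff_distrib)
  then show ?thesis by (simp add: sigma_order_in_def)
qed

lemma sigma_order_in_mono: "W \<subseteq> W' \<Longrightarrow> sigma_order_in \<sigma> W x \<Longrightarrow> sigma_order_in \<sigma> W' x"
  unfolding sigma_order_in_def by blast

lemma ex_sigma_split_mod:
  assumes W: "add_subgroup W" "open W"
  shows "\<exists>y\<in>top_generated {x}. sigma_order_in \<sigma> W y \<and> sigma_order_in (- \<sigma>) W (x - y)"
proof -
  obtain m where m: "m > 0" "zmul (int m) x \<in> W"
    using ex_multiple_in_open_subgroup[OF W] by blast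
  obtain a b where ab: "m = a * b" "\<And>q. prime q \<Longrightarrow> q dvd a \<Longrightarrow> q \<in> \<sigma>" "\<And>q. prime q \<Longrightarrow> q dvd b \<Longrightarrow> q \<notin> \<sigma>"
    using ex_prime_set_factorization[OF m(1), of \<sigma>] by blast
  have "coprime a b" using ab by (intro coprime_if_no_common_prime) blast
  then obtain u v where uv: "u * int a + v * int b = 1"
    using bezout_int[of "int a" "int b"] coprime_imp_gcd_eq_1[of "int a" "int b"] by auto
  \<comment> \<open>In \<open>x = u a x + v b x\<close> the second summand \<open>y\<close> is
    killed by \<open>a\<close> modulo \<open>W\<close>, and the first, \<open>x - y\<close>, by
    \<open>b\<close>.\<close>
  define y where "y = zmul (v * int b) x"
  have "x - y = zmul (u * int a) x"
    using arg_cong[OF uv, of "\<lambda>k. zmul k x"] by (simp add: y_def zmul.scale_left_distrib algebra_simps)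
  then have "zmul (int b) (x - y) \<in> W"
    using add_subgroup_zmul[OF W(1) m(2), of u] ab(1) by (simp add: mult_ac)
  moreover have "zmul (int a) y \<in> W"
    using add_subgroup_zmul[OF W(1) m(2), of v] ab(1) by (simp add: mult_ac y_def)
  ultimately have "sigma_order_in \<sigma> W y \<and> sigma_order_in (- \<sigma>) W (x - y)"
    unfolding sigma_order_in_def using ab m(1) by auto
  moreover have "y \<in> top_generated {x}"
    unfolding y_def by (intro add_subgroup_zmul add_subgroup_top_generated mem_top_generated_self)
  ultimately show ?thesis by blast
qed

text \<open>The splitting exists modulo every open subgroup by Bezout, so compactness of the procyclic
  group of \<open>x\<close> yields a global one.\<close>

lemma ex_sigma_split:
  "\<exists>y\<in>top_generated {x}. y \<in> sigma_elements \<sigma> \<and> x - y \<in> sigma_elements (- \<sigma>)"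
proof -
  define I where "I = {W::'a set. add_subgroup W \<and> open W}"
  define f where "f W = {y. sigma_order_in \<sigma> W y \<and> sigma_order_in (- \<sigma>) W (x - y)}" for W
  have "top_generated {x} \<inter> (\<Inter>W\<in>I. f W) \<noteq> {}"
  proof (rule compact_imp_fip_image)
    show "compact (top_generated {x})" by (simp add: compact_top_generated)
  next
    fix W assume W: "W \<in> I"
    show "closed (f W)"
      unfolding closed_iff_cosets
    proof (intro allI impI)
      fix z assume "\<forall>V. add_subgroup V \<and> open V \<longrightarrow> (\<exists>y\<in>f W. y - z \<in> V)"
      then obtain y where y: "y \<in> f W" "y - z \<in> W" using W unfolding I_def by blast
      have W': "add_subgroup W" using W by (simp add: I_def)
      have "(x - z) - (x - y) \<in> W" using y by simp
      then show "z \<in> f W"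
        using y(1) sigma_order_in_cong[OF W' y(2), of \<sigma>] sigma_order_in_cong[OF W', of "x - z" "x - y" "- \<sigma>"]
        by (simp add: f_def)
    qed
  next
    fix I' assume I': "finite I'" "I' \<subseteq> I"
    \<comment> \<open>Finitely many open subgroups are served by one splitting modulo their
      intersection, which is again an open subgroup.\<close>
    have "add_subgroup (\<Inter>I')" "open (\<Inter>I')"
      using I' by (auto simp: I_def intro!: add_subgroup_Inter open_Inter)
    then obtain y where y: "y \<in> top_generated {x}" "sigma_order_in \<sigma> (\<Inter>I') y" "sigma_order_in (- \<sigma>) (\<Inter>I') (x - y)"
      using ex_sigma_split_mod[of "\<Inter>I'" x \<sigma>] by blast
    then have "y \<in> (\<Inter>W\<in>I'. f W)"
      using sigma_order_in_mono[OF Inter_lower] by (auto simp: f_def)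
    then show "top_generated {x} \<inter> (\<Inter>W\<in>I'. f W) \<noteq> {}" using y(1) by blast
  qed
  then show ?thesis unfolding f_def I_def sigma_elements_iff by auto
qed

section \<open>Continuous projections onto the \<sigma>-parts\<close>

definition proj :: "nat set \<Rightarrow> 'a \<Rightarrow> 'a" where
  "proj \<sigma> x = (SOME y. y \<in> top_generated {x} \<and> y \<in> sigma_elements \<sigma> \<and> x - y \<in> sigma_elements (- \<sigma>))"

text \<open>The first property is the strong one: since the projection of \<open>x\<close> stays in
  the procyclic group of \<open>x\<close>, every closed subgroup is stable under all
  projections.\<close>

lemma proj_in_top_generated: "proj \<sigma> x \<in> top_generated {x}"
  and proj_in_sigma_elements: "proj \<sigma> x \<in> sigma_elements \<sigma>"
  and diff_proj_in_sigma_elements: "x - proj \<sigma> x \<in> sigma_elements (- \<sigma>)"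
proof -
  have "\<exists>y. y \<in> top_generated {x} \<and> y \<in> sigma_elements \<sigma> \<and> x - y \<in> sigma_elements (- \<sigma>)"
    using ex_sigma_split[of x \<sigma>] by blast
  from someI_ex[OF this] show "proj \<sigma> x \<in> top_generated {x}" "proj \<sigma> x \<in> sigma_elements \<sigma>"
    "x - proj \<sigma> x \<in> sigma_elements (- \<sigma>)"
    by (simp_all add: proj_def)
qed

lemma proj_unique:
  assumes "y \<in> sigma_elements \<sigma>" "x - y \<in> sigma_elements (- \<sigma>)"
  shows "proj \<sigma> x = y"
proof -
  have "proj \<sigma> x - y \<in> sigma_elements \<sigma>"
    by (intro add_subgroup_diff add_subgroup_sigma_elements proj_in_sigma_elements assms)
  moreover have "(x - y) - (x - proj \<sigma> x) \<in> sigma_elements (- \<sigma>)"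
    by (intro add_subgroup_diff[OF add_subgroup_sigma_elements] diff_proj_in_sigma_elements assms)
  ultimately have "proj \<sigma> x - y = 0"
    using sigma_elements_disjoint[of "proj \<sigma> x - y" \<sigma> "- \<sigma>"] by simp
  then show ?thesis by simp
qed

lemma proj_add: "proj \<sigma> (x + y) = proj \<sigma> x + proj \<sigma> y"
proof (rule proj_unique)
  show "proj \<sigma> x + proj \<sigma> y \<in> sigma_elements \<sigma>"
    by (intro add_subgroup_add add_subgroup_sigma_elements proj_in_sigma_elements)
  have "(x - proj \<sigma> x) + (y - proj \<sigma> y) \<in> sigma_elements (- \<sigma>)"
    by (intro add_subgroup_add[OF add_subgroup_sigma_elements] diff_proj_in_sigma_elements)
  then show "x + y - (proj \<sigma> x + proj \<sigma> y) \<in> sigma_elements (- \<sigma>)"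
    by (simp add: algebra_simps)
qed

lemma additive_proj: "Modules.additive (proj \<sigma>)"
  by (rule Modules.additive.intro) (rule proj_add)

lemmas proj_zero = Modules.additive.zero[OF additive_proj]
  and proj_diff = Modules.additive.diff[OF additive_proj]
  and proj_sum = Modules.additive.sum[OF additive_proj]

lemma proj_zmul: "proj \<sigma> (zmul n x) = zmul n (proj \<sigma> x)"
  by (simp add: zmul_def proj_diff proj_sum)

lemma proj_in_closed_subgroup: "closed_subgroup D \<Longrightarrow> x \<in> D \<Longrightarrow> proj \<sigma> x \<in> D"
  using top_generated_minimal[of D "{x}"] proj_in_top_generated[of \<sigma> x] by blast

text \<open>Open subgroups are closed and hence stable under the projection, and an additive map
  that preserves every member of a base at 0 is continuous.\<close>

lemma continuous_on_proj: "continuous_on S (proj \<sigma>)"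
proof -
  have "open (proj \<sigma> -` T)" if "open T" for T
  proof -
    have "\<exists>N. open N \<and> x \<in> N \<and> N \<subseteq> proj \<sigma> -` T" if x: "x \<in> proj \<sigma> -` T" for x
    proof -
      have "proj \<sigma> x \<in> T" using x by simp
      with \<open>open T\<close> obtain W
        where W: "add_subgroup W" "open W" "\<And>y. y - proj \<sigma> x \<in> W \<Longrightarrow> y \<in> T"
        by (rule coset_in_open) blast
      have "proj \<sigma> y \<in> T" if "y - x \<in> W" for y
        using W(3)[of "proj \<sigma> y"] proj_in_closed_subgroup[OF open_subgroup_closed_subgroup[OF W(1,2)] that, of \<sigma>]
        by (simp add: proj_diff)
      then show ?thesis
        using open_translation_add[OF W(2), of "- x"] add_subgroup_0[OF W(1)]
        by (intro exI[of _ "{y. - x + y \<in> W}"]) auto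
    qed
    then show ?thesis by (simp add: open_subopen[of "proj \<sigma> -` T"])
  qed
  then have "continuous_on UNIV (proj \<sigma>)" by (simp add: continuous_on_open_vimage)
  then show ?thesis by (rule continuous_on_subset) simp
qed

lemma proj_id: "x \<in> sigma_elements \<sigma> \<Longrightarrow> proj \<sigma> x = x"
  by (rule proj_unique) (auto intro: add_subgroup_0 add_subgroup_sigma_elements)

lemma proj_eq_0: "x \<in> sigma_elements \<tau> \<Longrightarrow> \<sigma> \<inter> \<tau> = {} \<Longrightarrow> proj \<sigma> x = 0"
  using sigma_elements_mono[of \<tau> "- \<sigma>"]
  by (intro proj_unique) (auto intro: add_subgroup_0 add_subgroup_sigma_elements)

text \<open>By Bezout two multipliers taking \<open>x\<close> into \<open>W\<close> can be replaced
  by their gcd, whose primes lie in both sets.\<close>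

lemma sigma_elements_Int: "sigma_elements (\<sigma> \<inter> \<tau>) = sigma_elements \<sigma> \<inter> sigma_elements \<tau>"
proof
  show "sigma_elements \<sigma> \<inter> sigma_elements \<tau> \<subseteq> sigma_elements (\<sigma> \<inter> \<tau>)"
  proof
    fix x assume x: "x \<in> sigma_elements \<sigma> \<inter> sigma_elements \<tau>"
    show "x \<in> sigma_elements (\<sigma> \<inter> \<tau>)"
      unfolding sigma_elements_iff
    proof clarify
      fix W :: "'a set" assume W: "add_subgroup W" "open W"
      obtain m where m: "m > 0" "\<And>q. prime q \<Longrightarrow> q dvd m \<Longrightarrow> q \<in> \<sigma>" "zmul (int m) x \<in> W"
        using sigma_elementsE[of x \<sigma>, OF _ W] x by blast
      obtain n where n: "n > 0" "\<And>q. prime q \<Longrightarrow> q dvd n \<Longrightarrow> q \<in> \<tau>" "zmul (int n) x \<in> W"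
        using sigma_elementsE[of x \<tau>, OF _ W] x by blast
      obtain u v where "u * int m + v * int n = gcd (int m) (int n)"
        using bezout_int by blast
      then have "zmul (int (gcd m n)) x = zmul u (zmul (int m) x) + zmul v (zmul (int n) x)"
        by (simp flip: zmul.scale_left_distrib)
      then have "zmul (int (gcd m n)) x \<in> W"
        using add_subgroup_add[OF W(1) add_subgroup_zmul[OF W(1) m(3)] add_subgroup_zmul[OF W(1) n(3)]] by metis
      then show "sigma_order_in (\<sigma> \<inter> \<tau>) W x"
        unfolding sigma_order_in_def using m n by (intro exI[of _ "gcd m n"]) auto
    qed
  qed
qed (auto intro: subsetD[OF sigma_elements_mono])

text \<open>The remainder avoids \<sigma> and avoids \<tau>, so \<open>sigma_elements_Int\<close>
  applies to it.\<close>

lemma proj_Un: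
  assumes "\<sigma> \<inter> \<tau> = {}" shows "proj (\<sigma> \<union> \<tau>) x = proj \<sigma> x + proj \<tau> x"
proof (rule proj_unique)
  show "proj \<sigma> x + proj \<tau> x \<in> sigma_elements (\<sigma> \<union> \<tau>)"
    using proj_in_sigma_elements[of \<sigma> x] proj_in_sigma_elements[of \<tau> x]
      sigma_elements_mono[of \<sigma> "\<sigma> \<union> \<tau>"] sigma_elements_mono[of \<tau> "\<sigma> \<union> \<tau>"]
    by (intro add_subgroup_add[OF add_subgroup_sigma_elements]) auto
  have 1: "x - proj \<sigma> x - proj \<tau> x \<in> sigma_elements (- \<sigma>)"
    using diff_proj_in_sigma_elements[of x \<sigma>] proj_in_sigma_elements[of \<tau> x]
      sigma_elements_mono[of \<tau> "- \<sigma>"] assms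
    by - (rule add_subgroup_diff[OF add_subgroup_sigma_elements], auto)
  have 2: "x - proj \<tau> x - proj \<sigma> x \<in> sigma_elements (- \<tau>)"
    using diff_proj_in_sigma_elements[of x \<tau>] proj_in_sigma_elements[of \<sigma> x]
      sigma_elements_mono[of \<sigma> "- \<tau>"] assms
    by - (rule add_subgroup_diff[OF add_subgroup_sigma_elements], auto)
  have "x - proj \<sigma> x - proj \<tau> x = x - (proj \<sigma> x + proj \<tau> x)"
    "x - proj \<tau> x - proj \<sigma> x = x - (proj \<sigma> x + proj \<tau> x)"
    by (simp_all add: algebra_simps)
  with 1 2 show "x - (proj \<sigma> x + proj \<tau> x) \<in> sigma_elements (- (\<sigma> \<union> \<tau>))"
    by (simp add: sigma_elements_Int)
qed

lemma proj_finite: "finite S \<Longrightarrow> proj S x = (\<Sum>p\<in>S. proj {p} x)"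
proof (induction S rule: finite_induct)
  case empty
  have "proj {} x = 0"
    by (rule proj_unique) (auto simp: sigma_elements_UNIV intro: add_subgroup_0 add_subgroup_sigma_elements)
  then show ?case by simp
next
  case (insert p S)
  then show ?case using proj_Un[of "{p}" S x] by simp
qed

text \<open>The local-global principle. Modulo \<open>W\<close> only the prime factors
  \<open>S\<close> of a multiplier \<open>m\<close> matter: \<open>proj S x\<close> is a finite sum
  of components in \<open>D\<close>, and the remainder is taken into \<open>W\<close> both by
  \<open>m\<close> and by a number prime to \<open>m\<close>, so it lies in
  \<open>W\<close>.\<close>

lemma sigma_elements_mem_closed_subgroup:
  assumes x: "x \<in> sigma_elements \<sigma>" and D: "closed_subgroup D"
    and mem: "\<And>p. p \<in> \<sigma> \<Longrightarrow> prime p \<Longrightarrow> proj {p} x \<in> D"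
  shows "x \<in> D"
proof (rule closed_subgroup_memI[OF D])
  fix W :: "'a set" assume W: "add_subgroup W" "open W"
  obtain m where m: "m > 0" "\<And>q. prime q \<Longrightarrow> q dvd m \<Longrightarrow> q \<in> \<sigma>" "zmul (int m) x \<in> W"
    using sigma_elementsE[OF x W] by blast
  define S where "S = prime_factors m"
  have "proj S x = (\<Sum>p\<in>S. proj {p} x)" by (rule proj_finite) (simp add: S_def)
  moreover have "(\<Sum>p\<in>S. proj {p} x) \<in> D"
    using D m mem by (intro add_subgroup_sum) (auto simp: S_def closed_subgroup_def in_prime_factors_iff)
  ultimately have D': "proj S x \<in> D" by simp
  obtain n where n: "n > 0" "\<And>q. prime q \<Longrightarrow> q dvd n \<Longrightarrow> q \<notin> S" "zmul (int n) (x - proj S x) \<in> W"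
    using sigma_elementsE[OF diff_proj_in_sigma_elements W] by (metis ComplD)
  have "zmul (int m) (proj S x) \<in> W"
    using proj_in_closed_subgroup[OF open_subgroup_closed_subgroup[OF W] m(3)] by (simp add: proj_zmul)
  then have "zmul (int m) (x - proj S x) \<in> W"
    using m(3) by (simp add: zmul.scale_right_diff_distrib add_subgroup_diff[OF W(1)])
  moreover have "coprime m n"
  proof (rule coprime_if_no_common_prime)
    fix q assume q: "prime q" "q dvd m" "q dvd n"
    then show False using n(2) m(1) by (simp add: S_def in_prime_factors_iff)
  qed
  ultimately have "x - proj S x \<in> W"
    using add_subgroup_zmul_coprime[OF W(1), of "int m" "int n"] n(3) by simp
  then show "x \<in> set_sum D W"
    using D' unfolding set_sum_def by (intro CollectI exI[of _ "proj S x"] exI[of _ "x - proj S x"]) simp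
qed

lemma mem_closed_subgroup_if_proj:
  "closed_subgroup D \<Longrightarrow> (\<And>p. prime p \<Longrightarrow> proj {p} x \<in> D) \<Longrightarrow> x \<in> D"
  using sigma_elements_mem_closed_subgroup[of x UNIV D] by (simp add: sigma_elements_UNIV)

section \<open>Agreement with primary components and primary parts\<close>

lemma sigma_elements_primeE:
  assumes x: "x \<in> sigma_elements {p}" and W: "add_subgroup W" "open W"
  obtains k where "zmul (int (p ^ k)) x \<in> W"
proof -
  obtain m where m: "m > 0" "\<And>q. prime q \<Longrightarrow> q dvd m \<Longrightarrow> q \<in> {p}" "zmul (int m) x \<in> W"
    by (rule sigma_elementsE[OF x W]) blast
  have "prime_factors m \<subseteq> {p}" using m(2) by (auto simp: in_prime_factors_iff)
  then have "m = p ^ multiplicity p m \<or> m = 1"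
    using prod_prime_factors[of m] m(1) by (auto simp: subset_singleton_iff)
  then obtain k where "m = p ^ k" by (metis power_0)
  then show ?thesis using m(3) that by blast
qed

text \<open>An open subgroup containing one \<open>p^k x\<close> contains all later ones, so
  convergence to 0 only asks that each open subgroup be reached.\<close>

lemma zmul_prime_power_tendsto_iff:
  assumes "prime p"
  shows "(\<lambda>k. \<Sum>i<p ^ k. x) \<longlonglongrightarrow> 0 \<longleftrightarrow> x \<in> sigma_elements {p}"
proof
  assume L: "(\<lambda>k. \<Sum>i<p ^ k. x) \<longlonglongrightarrow> 0"
  show "x \<in> sigma_elements {p}"
    unfolding sigma_elements_def sigma_order_in_def
  proof clarify
    fix W :: "'a set" assume W: "add_subgroup W" "open W"
    have "\<forall>\<^sub>F k in sequentially. (\<Sum>i<p ^ k. x) \<in> W"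
      using topological_tendstoD[OF L W(2)] add_subgroup_0[OF W(1)] by simp
    then obtain k where "(\<Sum>i<p ^ k. x) \<in> W" by (auto simp: eventually_sequentially)
    then show "\<exists>m>0. (\<forall>q. prime q \<and> q dvd m \<longrightarrow> q \<in> {p}) \<and> zmul (int m) x \<in> W"
      using assms prime_gt_0_nat[OF assms]
      by (intro exI[of _ "p ^ k"]) (auto simp: zmul_of_nat simp del: of_nat_power dest: prime_dvd_power primes_dvd_imp_eq)
  qed
next
  assume x: "x \<in> sigma_elements {p}"
  show "(\<lambda>k. \<Sum>i<p ^ k. x) \<longlonglongrightarrow> 0"
  proof (rule topological_tendstoI)
    fix S :: "'a set" assume "open S" "0 \<in> S"
    then obtain W where W: "add_subgroup W" "open W" "W \<subseteq> S" by (rule open_subgroup_base)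
    obtain k where k: "zmul (int (p ^ k)) x \<in> W"
      using sigma_elements_primeE[OF x W(1,2)] .
    have "(\<Sum>i<p ^ n. x) \<in> S" if "n \<ge> k" for n
    proof -
      have "int (p ^ k) dvd int (p ^ n)" using that by (simp add: le_imp_power_dvd)
      then have "zmul (int (p ^ n)) x \<in> W" using add_subgroup_zmul_dvd[OF W(1) k] by blast
      then show ?thesis using W(3) by (auto simp only: zmul_of_nat)
    qed
    then show "\<forall>\<^sub>F n in sequentially. (\<Sum>i<p ^ n. x) \<in> S" by (auto simp: eventually_sequentially)
  qed
qed

lemma primary_component_eq: "prime p \<Longrightarrow> primary_component UNIV p = sigma_elements {p}"
  by (simp add: primary_component_def zmul_prime_power_tendsto_iff)

lemma primary_part_eq:
  assumes "\<And>p. p \<in> \<sigma> \<Longrightarrow> prime p"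
  shows "primary_part UNIV \<sigma> = sigma_elements \<sigma>"
proof
  show "primary_part UNIV \<sigma> \<subseteq> sigma_elements \<sigma>"
    unfolding primary_part_def
    using assms by (intro top_generated_minimal closed_subgroup_sigma_elements)
      (auto simp: primary_component_eq intro: subsetD[OF sigma_elements_mono])
  show "sigma_elements \<sigma> \<subseteq> primary_part UNIV \<sigma>"
  proof
    fix x assume "x \<in> sigma_elements \<sigma>"
    then show "x \<in> primary_part UNIV \<sigma>"
      unfolding primary_part_def
    proof (rule sigma_elements_mem_closed_subgroup[OF _ closed_subgroup_top_generated])
      fix p assume "p \<in> \<sigma>" "prime p"
      then show "proj {p} x \<in> top_generated (\<Union>p\<in>\<sigma>. primary_component UNIV p)"
        using proj_in_sigma_elements[of "{p}" x]
          by (intro subsetD[OF top_generated_superset]) (auto simp: primary_component_eq intro!: bexI[of _ p])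
    qed
  qed
qed

text \<open>The sum is cut out by two closed conditions, \<open>proj \<sigma> z\<close> in
  \<open>S\<close> and the remainder in \<open>T\<close>, and both maps are continuous.\<close>

lemma closed_set_sum_disjoint:
  assumes "closed S" "closed T" "S \<subseteq> sigma_elements \<sigma>" "T \<subseteq> sigma_elements \<tau>" "\<sigma> \<inter> \<tau> = {}"
  shows "closed (set_sum S T)"
proof -
  have "set_sum S T = proj \<sigma> -` S \<inter> (\<lambda>z. z - proj \<sigma> z) -` T"
  proof (intro subset_antisym subsetI)
    fix z assume "z \<in> set_sum S T"
    then obtain s t where st: "z = s + t" "s \<in> S" "t \<in> T" by (auto simp: set_sum_def)
    have "s \<in> sigma_elements \<sigma>" "t \<in> sigma_elements \<tau>" using st assms by auto
    then have "proj \<sigma> z = s"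
      using proj_id[of s \<sigma>] proj_eq_0[of t \<tau> \<sigma>] assms(5) by (simp add: st(1) proj_add)
    then show "z \<in> proj \<sigma> -` S \<inter> (\<lambda>z. z - proj \<sigma> z) -` T" using st by simp
  next
    fix z assume "z \<in> proj \<sigma> -` S \<inter> (\<lambda>z. z - proj \<sigma> z) -` T"
    then show "z \<in> set_sum S T"
      unfolding set_sum_def by (intro CollectI exI[of _ "proj \<sigma> z"] exI[of _ "z - proj \<sigma> z"]) auto
  qed
  moreover have "closed (proj \<sigma> -` S)" "closed ((\<lambda>z. z - proj \<sigma> z) -` T)"
    by (intro closed_vimage assms continuous_on_proj continuous_on_diff continuous_on_id)+
  ultimately show ?thesis by (metis closed_Int)
qed

text \<open>As in a restricted product: once \<open>m x\<close> is in \<open>W\<close>, only prime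
  divisors of \<open>m\<close> can give a component outside \<open>W\<close>.\<close>

lemma finite_proj_notin_open_subgroup:
  assumes W: "add_subgroup W" "open W"
  shows "finite {p. prime p \<and> proj {p} x \<notin> W}"
proof -
  obtain m where m: "m > 0" "zmul (int m) x \<in> W"
    using ex_multiple_in_open_subgroup[OF W] by blast
  have "p \<in> prime_factors m" if p: "prime p" "proj {p} x \<notin> W" for p
  proof (rule ccontr)
    assume np: "p \<notin> prime_factors m"
    obtain n where n: "n > 0" "\<And>q. prime q \<Longrightarrow> q dvd n \<Longrightarrow> q \<in> {p}" "zmul (int n) (proj {p} x) \<in> W"
      by (rule sigma_elementsE[OF proj_in_sigma_elements[of "{p}" x] W]) blast
    have "zmul (int m) (proj {p} x) \<in> W"
      using proj_in_closed_subgroup[OF open_subgroup_closed_subgroup[OF W] m(2)] by (simp add: proj_zmul)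
    moreover have "coprime m n"
    proof (rule coprime_if_no_common_prime)
      fix q assume q: "prime q" "q dvd m" "q dvd n"
      then have "q = p" using n(2) by blast
      then show False using np m(1) q by (simp add: in_prime_factors_iff)
    qed
    ultimately show False
      using add_subgroup_zmul_coprime[OF W(1), of "int m" "int n"] n(3) p(2) by auto
  qed
  then show ?thesis by (intro finite_subset[OF _ finite_set_mset[of "prime_factorization m"]]) auto
qed

section \<open>Procyclic subgroups of a primary component\<close>

text \<open>The procyclic group is compact, so its image under multiplication by \<open>n\<close> is
  already closed.\<close>

lemma top_generated_zmul:
  fixes g :: 'a
  shows "top_generated {zmul n g} = zmul n ` top_generated {g}"
proof
  show "zmul n ` top_generated {g} \<subseteq> top_generated {zmul n g}"
    using additive_top_generated_image[OF additive_zmul continuous_on_zmul, of n "{g}"] by simp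
  have "add_subgroup (zmul n ` top_generated {g})"
    by (intro additive_image_subgroup additive_zmul add_subgroup_top_generated)
  moreover have "compact (zmul n ` top_generated {g})"
    by (intro compact_continuous_image continuous_on_zmul compact_top_generated) simp
  ultimately show "top_generated {zmul n g} \<subseteq> zmul n ` top_generated {g}"
    by (intro top_generated_minimal compact_subgroup_closed) (simp_all add: mem_top_generated_self)
qed

lemma zmul_mem_top_generated_zmul:
  "(x::'a) \<in> top_generated {g} \<Longrightarrow> zmul n x \<in> top_generated {zmul n g}"
  by (simp add: top_generated_zmul)

text \<open>Reduction modulo \<open>n\<close> leaves finitely many cosets of the compact group of
  \<open>n g\<close>; their union is closed and therefore exhausts the procyclic group of
  \<open>g\<close>.\<close>

lemma top_generated_singleton_decomp:
  fixes g h :: 'a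
  assumes h: "h \<in> top_generated {g}" and n: "n > 0"
  obtains i w where "h = zmul i g + w" "w \<in> top_generated {zmul n g}"
proof -
  let ?C = "top_generated {zmul n g}"
  let ?T = "set_sum (range (\<lambda>i. zmul i g)) ?C"
  let ?F = "(\<lambda>i. zmul i g) ` {0..<n}"
  have rg: "add_subgroup (range (\<lambda>i. zmul i g))"
    unfolding add_subgroup_def
    by (auto simp flip: zmul.scale_left_distrib zmul.scale_minus_left intro: range_eqI[of _ _ 0])
  then have sub: "add_subgroup ?T" by (intro add_subgroup_set_sum add_subgroup_top_generated)
  have "?T \<subseteq> set_sum ?F ?C"
  proof
    fix t assume "t \<in> ?T"
    then obtain i w where t: "t = zmul i g + w" "w \<in> ?C" by (auto simp: set_sum_def)
    have "zmul i g = zmul (i mod n) g + zmul (i div n) (zmul n g)"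
      by (simp flip: zmul.scale_left_distrib)
    then have "t = zmul (i mod n) g + (zmul (i div n) (zmul n g) + w)" using t by (simp only: add.assoc)
    moreover have "zmul (i div n) (zmul n g) + w \<in> ?C"
      by (intro add_subgroup_add[OF add_subgroup_top_generated] t
          add_subgroup_zmul[OF add_subgroup_top_generated] mem_top_generated_self)
    moreover have "i mod n \<in> {0..<n}" using n by simp
    ultimately show "t \<in> set_sum ?F ?C" unfolding set_sum_def by blast
  qed
  moreover have "set_sum ?F ?C \<subseteq> ?T" by (auto simp: set_sum_def)
  ultimately have "?T = set_sum ?F ?C" by simp
  moreover have "compact (set_sum ?F ?C)"
    by (intro compact_set_sum compact_top_generated finite_imp_compact) auto
  ultimately have "closed_subgroup ?T" using sub by (intro compact_subgroup_closed) simp_all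
  moreover have "g \<in> range (\<lambda>i. zmul i g)" by (rule range_eqI[of _ _ 1]) simp
  then have "{g} \<subseteq> ?T" using set_sum_superset[OF rg add_subgroup_top_generated] by blast
  ultimately have "h \<in> ?T" using h top_generated_minimal by blast
  then show ?thesis using that by (auto simp: set_sum_def)
qed

text \<open>Topological Nakayama lemma: the hypothesis improves itself to \<open>v\<close> in
  \<open>D\<close> plus the group of \<open>p^k v\<close> for every \<open>k\<close>, and
  \<open>p^k v\<close> eventually enters each open subgroup.\<close>

lemma nakayama_procyclic:
  assumes v: "v \<in> sigma_elements {p}" and p: "prime p" and D: "closed_subgroup D"
    and mem: "v \<in> set_sum D (top_generated {zmul (int p) v})"
  shows "v \<in> D"
proof -
  have D': "add_subgroup D" using D by (simp add: closed_subgroup_def)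
  obtain d0 w0 where d0: "v = d0 + w0" "d0 \<in> D" "w0 \<in> top_generated {zmul (int p) v}"
    using mem by (auto simp: set_sum_def)
  have step: "v \<in> set_sum D (top_generated {zmul (int (p ^ k)) v})" for k
  proof (induction k)
    case 0
    then show ?case
      using set_sum_superset(2)[OF D' add_subgroup_top_generated[of "{v}"]] mem_top_generated_self[of v] by auto
  next
    case (Suc k)
    let ?n = "int (p ^ k)"
    have pk: "zmul ?n (zmul (int p) v) = zmul (int (p ^ Suc k)) v"
      by (simp add: mult.commute)
    obtain d w where dw: "v = d + w" "d \<in> D" "w \<in> top_generated {zmul ?n v}"
      using Suc by (auto simp: set_sum_def)
    then obtain u where u: "w = zmul ?n u" "u \<in> top_generated {v}"
      unfolding top_generated_zmul[of ?n v] by blast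
    obtain i w' where w': "u = zmul i v + w'" "w' \<in> top_generated {zmul (int p) v}"
      using top_generated_singleton_decomp[OF u(2), of "int p"] prime_gt_0_nat[OF p] by (metis of_nat_0_less_iff)
    \<comment> \<open>In \<open>w = p^k u\<close> with \<open>u = i v + w'\<close>, substituting
      \<open>v = d0 + w0\<close> splits off \<open>i d0\<close> in \<open>D\<close>. The rest lies
      in the group of \<open>p v\<close>, so multiplying it by \<open>p^k\<close> reaches that of
      \<open>p^(k+1) v\<close>.\<close>
    have "zmul i w0 + w' \<in> top_generated {zmul (int p) v}"
      by (intro add_subgroup_add[OF add_subgroup_top_generated] add_subgroup_zmul[OF add_subgroup_top_generated] w' d0)
    then have "zmul ?n (zmul i w0 + w') \<in> top_generated {zmul (int (p ^ Suc k)) v}"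
      using zmul_mem_top_generated_zmul[of _ "zmul (int p) v" ?n] by (metis pk)
    moreover have "d + zmul ?n (zmul i d0) \<in> D"
      by (intro add_subgroup_add[OF D'] add_subgroup_zmul[OF D'] dw d0)
    moreover have "u = zmul i d0 + (zmul i w0 + w')"
      using w'(1) arg_cong[OF d0(1), of "zmul i"] by (simp add: zmul.scale_right_distrib add.assoc)
    then have "v = (d + zmul ?n (zmul i d0)) + zmul ?n (zmul i w0 + w')"
      using dw(1) u(1) by (simp only: zmul.scale_right_distrib add.assoc)
    ultimately show ?case unfolding set_sum_def by blast
  qed
  show ?thesis
  proof (rule closed_subgroup_memI[OF D])
    fix W :: "'a set" assume W: "add_subgroup W" "open W"
    obtain k where k: "zmul (int (p ^ k)) v \<in> W" using sigma_elements_primeE[OF v W] .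
    then have "top_generated {zmul (int (p ^ k)) v} \<subseteq> W"
      by (intro top_generated_minimal open_subgroup_closed_subgroup W) auto
    then show "v \<in> set_sum D W" using step[of k] unfolding set_sum_def by blast
  qed
qed

text \<open>Like a unit of the p-adic integers: modulo the group of \<open>p g\<close>,
  \<open>h\<close> is \<open>i g\<close> with \<open>i\<close> prime to \<open>p\<close>. Inverting
  \<open>i\<close> modulo \<open>p\<close> gives \<open>g\<close> up to an element of that group,
  which Nakayama absorbs.\<close>

lemma procyclic_generator:
  assumes g: "g \<in> sigma_elements {p}" and p: "prime p"
    and h: "h \<in> top_generated {g}" "h \<notin> top_generated {zmul (int p) g}"
  shows "g \<in> top_generated {h}"
proof -
  let ?C = "top_generated {zmul (int p) g}"
  note sC = add_subgroup_top_generated[of "{zmul (int p) g}"]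
  obtain i w where iw: "h = zmul i g + w" "w \<in> ?C"
    using top_generated_singleton_decomp[OF h(1), of "int p"] prime_gt_0_nat[OF p] by (metis of_nat_0_less_iff)
  have "\<not> int p dvd i"
  proof
    assume "int p dvd i"
    then have "zmul i g \<in> ?C"
      using add_subgroup_zmul_dvd[OF sC, of "int p" g i] mem_top_generated_self[of "zmul (int p) g"] by blast
    then show False using iw h(2) add_subgroup_add[OF sC] by blast
  qed
  moreover have "prime (int p)" using p by simp
  ultimately have "coprime (int p) i" by (simp add: prime_imp_coprime)
  then obtain l u where lu: "l * int p + u * i = 1"
    using bezout_int[of "int p" i] coprime_imp_gcd_eq_1[of "int p" i] by metis
  have "g = zmul u h + (zmul l (zmul (int p) g) - zmul u w)"
    using iw(1) arg_cong[OF lu, of "\<lambda>k. zmul k g"]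
    by (simp add: zmul.scale_right_distrib zmul.scale_left_distrib algebra_simps)
  moreover have "zmul u h \<in> top_generated {h}"
    by (intro add_subgroup_zmul add_subgroup_top_generated mem_top_generated_self)
  moreover have "zmul l (zmul (int p) g) - zmul u w \<in> ?C"
    by (intro add_subgroup_diff[OF sC] add_subgroup_zmul[OF sC] mem_top_generated_self iw)
  ultimately have "g \<in> set_sum (top_generated {h}) ?C" unfolding set_sum_def by blast
  then show ?thesis by (rule nakayama_procyclic[OF g p closed_subgroup_top_generated])
qed

lemma procyclic_subgroup_eq_power:
  assumes g: "g \<in> sigma_elements {p}" and p: "prime p" and x: "x \<in> top_generated {g}" "x \<noteq> 0"
  obtains k where "x \<in> top_generated {zmul (int (p ^ k)) g}" "zmul (int (p ^ k)) g \<in> top_generated {x}"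
proof -
  have sg: "sigma_elements {p} \<supseteq> top_generated {g}"
    using g by (intro top_generated_minimal closed_subgroup_sigma_elements) auto
  obtain W where W: "add_subgroup W" "open W" "x \<notin> W"
    using eq_0_if_in_open_subgroups[of x] x(2) by blast
  obtain n where n: "zmul (int (p ^ n)) g \<in> W" using sigma_elements_primeE[OF g W(1,2)] .
  \<comment> \<open>Sought is the last power of \<open>p\<close> whose multiple of \<open>g\<close>
    still generates \<open>x\<close>. A failing exponent exists because \<open>W\<close> separates
    \<open>x\<close> from 0, and the first one is positive because \<open>x\<close> is in the group
    of \<open>g\<close>.\<close>
  let ?P = "\<lambda>n. x \<notin> top_generated {zmul (int (p ^ n)) g}"
  have "?P n"
    using W n top_generated_minimal[OF open_subgroup_closed_subgroup[OF W(1,2)], of "{zmul (int (p ^ n)) g}"] by blast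
  then have P: "?P (LEAST n. ?P n)" by (rule LeastI)
  moreover have "\<not> ?P 0" using x by simp
  ultimately obtain k where k: "(LEAST n. ?P n) = Suc k" by (metis not0_implies_Suc)
  then have "\<not> ?P k" using not_less_Least[of k ?P] by simp
  then have 1: "x \<in> top_generated {zmul (int (p ^ k)) g}" by simp
  moreover have "x \<notin> top_generated {zmul (int p) (zmul (int (p ^ k)) g)}"
    using P k by simp
  moreover have "zmul (int (p ^ k)) g \<in> sigma_elements {p}"
    by (intro add_subgroup_zmul add_subgroup_sigma_elements g)
  ultimately have "zmul (int (p ^ k)) g \<in> top_generated {x}" using procyclic_generator p by blast
  with 1 show ?thesis using that by blast
qed

text \<open>Nonzero elements are compared by the exponents from
  \<open>procyclic_subgroup_eq_power\<close>; 0 need not have one and is treated apart.\<close>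

lemma procyclic_chain:
  assumes g: "g \<in> sigma_elements {p}" and p: "prime p"
    and xy: "x \<in> top_generated {g}" "y \<in> top_generated {g}"
  shows "x \<in> top_generated {y} \<or> y \<in> top_generated {x}"
proof (cases "x = 0 \<or> y = 0")
  case True
  then show ?thesis using add_subgroup_0[OF add_subgroup_top_generated] by auto
next
  case False
  then obtain i j where ij: "x \<in> top_generated {zmul (int (p ^ i)) g}" "zmul (int (p ^ i)) g \<in> top_generated {x}"
    "y \<in> top_generated {zmul (int (p ^ j)) g}" "zmul (int (p ^ j)) g \<in> top_generated {y}"
    using procyclic_subgroup_eq_power[OF g p xy(1)] procyclic_subgroup_eq_power[OF g p xy(2)] by metis
  have *: "b \<in> top_generated {a}"
    if "zmul (int (p ^ i)) g \<in> top_generated {a}" "b \<in> top_generated {zmul (int (p ^ j)) g}" "i \<le> j" for a b i j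
  proof -
    have "int (p ^ i) dvd int (p ^ j)" using that(3) by (simp add: le_imp_power_dvd)
    then have "zmul (int (p ^ j)) g \<in> top_generated {a}"
      using that(1) by (blast intro: add_subgroup_zmul_dvd[OF add_subgroup_top_generated])
    then show ?thesis
      using that(2) top_generated_minimal[OF closed_subgroup_top_generated, of "{zmul (int (p ^ j)) g}" "{a}"] by blast
  qed
  show ?thesis
  proof (cases "i \<le> j")
    case True
    then show ?thesis using *[OF ij(2,3)] by blast
  next
    case False
    then show ?thesis using *[OF ij(4,1)] by simp
  qed
qed

section \<open>Chains of procyclic subgroups and rank at most one\<close>

definition divisibility_chain :: "'a set \<Rightarrow> bool" where
  "divisibility_chain G \<longleftrightarrow> (\<forall>x\<in>G. \<forall>y\<in>G. x \<in> top_generated {y} \<or> y \<in> top_generated {x})"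

lemma divisibility_chain_procyclic:
  assumes G: "divisibility_chain G" "0 \<in> G" and F: "finite F" "F \<subseteq> G"
  shows "\<exists>g\<in>G. top_generated F = top_generated {g}"
  using F
proof (induction F)
  case empty
  have "top_generated {} = top_generated {0::'a}" by (simp add: top_generated_def)
  then show ?case using G(2) by blast
next
  case (insert x F)
  then obtain g where g: "g \<in> G" "top_generated F = top_generated {g}" by blast
  have eq: "top_generated (insert x F) = top_generated {x, g}"
    by (rule top_generated_insert_cong[OF g(2)])
  show ?case
  proof (cases "x \<in> top_generated {g}")
    case True
    then show ?thesis using eq g(1) top_generated_insert_subset by metis
  next
    case False
    then have "g \<in> top_generated {x}"
      using G(1) g(1) insert.prems by (auto simp: divisibility_chain_def)
    then show ?thesis
      using eq insert.prems top_generated_insert_subset[of g "{x}"] by (metis insert_commute insert_subset)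
  qed
qed

text \<open>A common generator of \<open>x\<close> and \<open>y\<close> reduces one direction to the
  chain inside its procyclic group; conversely comparability absorbs generators one by one. A single
  prime is essential: elements of orders 2 and 3 in a cyclic group of order 6 are not
  comparable.\<close>

lemma inductively_monothetic_iff_chain:
  assumes p: "prime p"
  shows "inductively_monothetic (sigma_elements {p}) \<longleftrightarrow> divisibility_chain (sigma_elements {p})"
proof
  assume im: "inductively_monothetic (sigma_elements {p})"
  show "divisibility_chain (sigma_elements {p})"
    unfolding divisibility_chain_def
  proof (intro ballI)
    fix x y assume xy: "x \<in> sigma_elements {p}" "y \<in> sigma_elements {p}"
    have sub: "top_generated {x, y} \<subseteq> sigma_elements {p}"
      using xy by (intro top_generated_minimal closed_subgroup_sigma_elements) auto
    moreover have "top_finitely_generated (top_generated {x, y})"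
      by (simp add: top_finitely_generated_top_generated)
    ultimately obtain g where g: "top_generated {x, y} = top_generated {g}"
      using im closed_subgroup_top_generated unfolding inductively_monothetic_def by blast
    then have "g \<in> sigma_elements {p}" "x \<in> top_generated {g}" "y \<in> top_generated {g}"
      using sub mem_top_generated_self[of g] top_generated_superset[of "{x, y}"] by auto
    then show "x \<in> top_generated {y} \<or> y \<in> top_generated {x}" by (rule procyclic_chain[OF _ p])
  qed
next
  assume ch: "divisibility_chain (sigma_elements {p})"
  show "inductively_monothetic (sigma_elements {p})"
    unfolding inductively_monothetic_def top_finitely_generated_def
  proof clarify
    fix F assume "finite F" "top_generated F \<subseteq> sigma_elements {p}"
    then show "\<exists>x. top_generated F = top_generated {x}"
      using divisibility_chain_procyclic[OF ch add_subgroup_0[OF add_subgroup_sigma_elements]]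
        top_generated_superset[of F] by (metis order_trans)
  qed
qed

lemma inductively_monothetic_subset:
  "inductively_monothetic G \<Longrightarrow> H \<subseteq> G \<Longrightarrow> inductively_monothetic H"
  unfolding inductively_monothetic_def by blast

text \<open>Rank below 2 allows zero or one generator, and having none amounts to the generator 0.
  This turns the rank condition on \<phi> into a failure of the chain condition.\<close>

lemma top_rank_ge_2_iff: "top_rank G \<ge> 2 \<longleftrightarrow> \<not> inductively_monothetic (G :: 'a set)"
proof -
  let ?P = "\<lambda>n. \<forall>H. H \<subseteq> G \<and> closed_subgroup H \<and> top_finitely_generated H \<longrightarrow>
    (\<exists>F. finite F \<and> card F \<le> n \<and> H = top_generated F)"
  have "(\<exists>n. enat n < 2 \<and> ?P n) \<longleftrightarrow> inductively_monothetic G"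
  proof
    assume "\<exists>n. enat n < 2 \<and> ?P n"
    then obtain n where n: "enat n < 2" "?P n" by blast
    have "n \<le> 1" using n(1) by (simp add: numeral_eq_enat)
    show "inductively_monothetic G"
      unfolding inductively_monothetic_def
    proof (intro allI impI)
      fix H assume "H \<subseteq> G \<and> closed_subgroup H \<and> top_finitely_generated H"
      then obtain F where F: "finite F" "card F \<le> n" "H = top_generated F" using n(2) by blast
      have "card F = 0 \<or> card F = 1" using F(2) \<open>n \<le> 1\<close> by linarith
      then have "F = {} \<or> (\<exists>x. F = {x})" using F(1) by (auto simp: card_1_singleton_iff)
      moreover have "top_generated {} = top_generated {0::'a}" by (simp add: top_generated_def)
      ultimately show "\<exists>x. H = top_generated {x}" using F(3) by metis
    qed
  next
    assume im: "inductively_monothetic G"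
    have "?P 1"
    proof (intro allI impI)
      fix H assume "H \<subseteq> G \<and> closed_subgroup H \<and> top_finitely_generated H"
      then obtain x where "H = top_generated {x}" using im unfolding inductively_monothetic_def by blast
      then show "\<exists>F. finite F \<and> card F \<le> 1 \<and> H = top_generated F" by (intro exI[of _ "{x}"]) simp
    qed
    moreover have "enat 1 < 2" by (simp add: numeral_eq_enat)
    ultimately show "\<exists>n. enat n < 2 \<and> ?P n" by blast
  qed
  moreover have "top_rank G < 2 \<longleftrightarrow> (\<exists>n. enat n < 2 \<and> ?P n)"
    unfolding top_rank_def Inf_less_iff by auto
  ultimately show ?thesis by (metis not_less)
qed

section \<open>Strong quasihamiltonicity\<close>

lemma strongly_top_quasihamiltonian_iff:
  "strongly_top_quasihamiltonian G \<longleftrightarrow>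
    (\<forall>X Y. X \<subseteq> G \<and> closed_subgroup X \<and> Y \<subseteq> G \<and> closed_subgroup Y \<longrightarrow> closed (set_sum X Y))"
  by (simp add: strongly_top_quasihamiltonian_def set_sum_def)

lemma strongly_top_quasihamiltonian_subset:
  "strongly_top_quasihamiltonian G \<Longrightarrow> H \<subseteq> G \<Longrightarrow> strongly_top_quasihamiltonian H"
  unfolding strongly_top_quasihamiltonian_iff by blast

text \<open>A Chinese remainder theorem for possibly infinitely many primes: finite sums realise
  finitely many components inside \<open>K\<close>, and compactness realises all of them at
  once.\<close>

lemma ex_with_projections:
  assumes K: "closed_subgroup K" "compact K"
    and v: "\<And>p. p \<in> S \<Longrightarrow> v p \<in> K \<inter> sigma_elements {p}"
  obtains z where "z \<in> K" "\<And>p. p \<in> S \<Longrightarrow> proj {p} z = v p"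
proof -
  have "K \<inter> (\<Inter>p\<in>S. proj {p} -` {v p}) \<noteq> {}"
  proof (rule compact_imp_fip_image[OF K(2)])
    show "closed (proj {p} -` {v p})" for p
      by (intro closed_vimage continuous_on_proj) auto
  next
    fix F assume F: "finite F" "F \<subseteq> S"
    have "proj {p} (\<Sum>q\<in>F. v q) = v p" if "p \<in> F" for p
    proof -
      have "proj {p} (\<Sum>q\<in>F. v q) = (\<Sum>q\<in>F. if q = p then v p else 0)"
        unfolding proj_sum
      proof (rule sum.cong[OF refl])
        fix q assume "q \<in> F"
        then have "v q \<in> sigma_elements {q}" using v F by blast
        then show "proj {p} (v q) = (if q = p then v p else 0)"
          using proj_id[of "v q" "{q}"] proj_eq_0[of "v q" "{q}" "{p}"] by auto
      qed
      then show ?thesis using that F(1) by simp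
    qed
    moreover have "(\<Sum>q\<in>F. v q) \<in> K"
      using v F K(1) by (intro add_subgroup_sum) (auto simp: closed_subgroup_def)
    ultimately show "K \<inter> (\<Inter>p\<in>F. proj {p} -` {v p}) \<noteq> {}" by blast
  qed
  then obtain z where "z \<in> K" "z \<in> (\<Inter>p\<in>S. proj {p} -` {v p})" by blast
  then show ?thesis by (intro that[of z]) auto
qed

text \<open>Generators \<open>h p\<close> of the p-parts of the subgroup are glued, inside this
  compact subgroup, to one element \<open>z\<close>. As \<open>proj {p} z\<close> stays in the
  procyclic group of \<open>z\<close>, that group recovers every \<open>h p\<close>.\<close>

lemma inductively_monothetic_sigma_elements:
  assumes \<sigma>: "\<And>p. p \<in> \<sigma> \<Longrightarrow> inductively_monothetic (sigma_elements {p})"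
  shows "inductively_monothetic (sigma_elements \<sigma>)"
  unfolding inductively_monothetic_def top_finitely_generated_def
proof clarify
  fix F assume H: "top_generated F \<subseteq> sigma_elements \<sigma>" and F: "finite F"
  let ?H = "top_generated F"
  have "\<exists>h. top_generated (proj {p} ` F) = top_generated {h}" if "p \<in> \<sigma>" for p
  proof -
    have "top_generated (proj {p} ` F) \<subseteq> sigma_elements {p}"
      by (intro top_generated_minimal closed_subgroup_sigma_elements) (auto simp: proj_in_sigma_elements)
    moreover have "top_finitely_generated (top_generated (proj {p} ` F))"
      using F by (simp add: top_finitely_generated_top_generated)
    ultimately show ?thesis
      using \<sigma>[OF that] closed_subgroup_top_generated unfolding inductively_monothetic_def by blast
  qed
  then obtain h where h: "\<And>p. p \<in> \<sigma> \<Longrightarrow> top_generated (proj {p} ` F) = top_generated {h p}" by metis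
  have "h p \<in> ?H \<inter> sigma_elements {p}" if "p \<in> \<sigma>" for p
  proof -
    have "proj {p} ` F \<subseteq> ?H"
      using top_generated_superset[of F] proj_in_closed_subgroup[OF closed_subgroup_top_generated] by blast
    then have "top_generated (proj {p} ` F) \<subseteq> ?H \<inter> sigma_elements {p}"
      using proj_in_sigma_elements
      by (intro top_generated_minimal closed_subgroup_Int closed_subgroup_top_generated
          closed_subgroup_sigma_elements) blast
    then show ?thesis using h[OF that] mem_top_generated_self by blast
  qed
  then obtain z where z: "z \<in> ?H" "\<And>p. p \<in> \<sigma> \<Longrightarrow> proj {p} z = h p"
    using ex_with_projections[OF closed_subgroup_top_generated compact_top_generated[OF F], of \<sigma> h] by blast
  have "F \<subseteq> top_generated {z}"
  proof
    fix f assume f: "f \<in> F"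
    show "f \<in> top_generated {z}"
    proof (rule sigma_elements_mem_closed_subgroup[OF _ closed_subgroup_top_generated])
      show "f \<in> sigma_elements \<sigma>" using f H top_generated_superset by blast
    next
      fix p assume p: "p \<in> \<sigma>"
      have "proj {p} f \<in> top_generated {h p}"
        using f h[OF p] top_generated_superset[of "proj {p} ` F"] by blast
      moreover have "h p \<in> top_generated {z}"
        using z(2)[OF p] proj_in_top_generated[of "{p}" z] by simp
      ultimately show "proj {p} f \<in> top_generated {z}"
        using top_generated_minimal[OF closed_subgroup_top_generated, of "{h p}" "{z}"] by blast
    qed
  qed
  then have "?H \<subseteq> top_generated {z}" by (intro top_generated_minimal closed_subgroup_top_generated)
  moreover have "top_generated {z} \<subseteq> ?H"
    using z(1) by (intro top_generated_minimal closed_subgroup_top_generated) auto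
  ultimately show "\<exists>x. ?H = top_generated {x}" by blast
qed

section \<open>Discrete, compact and inductively monothetic parts\<close>

lemma sigma_elements_Int_open_trivial:
  assumes "\<And>p. p \<in> \<sigma> \<Longrightarrow> sigma_elements {p} \<inter> U = {0}"
  shows "sigma_elements \<sigma> \<inter> U = {0}"
proof
  show "sigma_elements \<sigma> \<inter> U \<subseteq> {0}"
  proof
    fix x assume x: "x \<in> sigma_elements \<sigma> \<inter> U"
    show "x \<in> {0}"
    proof (rule sigma_elements_mem_closed_subgroup[OF _ closed_subgroup_trivial])
      show "x \<in> sigma_elements \<sigma>" using x by simp
      fix p assume "p \<in> \<sigma>"
      moreover have "proj {p} x \<in> U"
        using x by (auto intro: proj_in_closed_subgroup open_subgroup_closed_subgroup subgroup_U open_U)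
      ultimately show "proj {p} x \<in> {0}" using assms proj_in_sigma_elements by blast
    qed
  qed
qed (auto intro: add_subgroup_0 add_subgroup_sigma_elements subgroup_U)

lemma sigma_elements_subset_closed_subgroup:
  assumes "closed_subgroup D" "\<And>p. p \<in> \<sigma> \<Longrightarrow> sigma_elements {p} \<subseteq> D"
  shows "sigma_elements \<sigma> \<subseteq> D"
  using sigma_elements_mem_closed_subgroup[of _ \<sigma> D] assms proj_in_sigma_elements by blast

lemma discrete_if_Int_open_trivial:
  assumes "add_subgroup G" "G \<inter> U = {0}" shows "discrete G"
proof (rule discreteI)
  fix x assume x: "x \<in> G"
  have "{y. - x + y \<in> U} \<inter> G = {x}"
  proof (intro subset_antisym subsetI)
    fix y assume "y \<in> {y. - x + y \<in> U} \<inter> G"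
    then have "- x + y \<in> G \<inter> U"
      using x assms(1) by (auto intro!: add_subgroup_diff)
    then show "y \<in> {x}" using assms(2) by (simp add: add_eq_0_iff)
  qed (use x subgroup_U in \<open>auto simp: add_subgroup_0\<close>)
  then show "x isolated_in G"
    unfolding isolated_in_def using x open_translation_add[OF open_U, of "- x"] by blast
qed

text \<open>Two elements of \<open>S\<close> in the coset \<open>x + U\<close> differ by an element
  of \<open>S \<inter> U\<close>, so they coincide. Hence the same \<open>y\<close> approximates
  \<open>x\<close> modulo every open subgroup.\<close>

lemma closed_if_Int_open_trivial:
  assumes "add_subgroup S" "S \<inter> U = {0}" shows "closed S"
  unfolding closed_iff_cosets
proof (intro allI impI)
  fix x assume *: "\<forall>W. add_subgroup W \<and> open W \<longrightarrow> (\<exists>y\<in>S. y - x \<in> W)"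
  then obtain y where y: "y \<in> S" "y - x \<in> U" using subgroup_U open_U by blast
  have "y - x = 0"
  proof (rule eq_0_if_in_open_subgroups)
    fix W :: "'a set" assume W: "add_subgroup W" "open W"
    then have "add_subgroup (W \<inter> U)" "open (W \<inter> U)"
      using subgroup_U open_U by (auto intro: add_subgroup_Int)
    then obtain y' where y': "y' \<in> S" "y' - x \<in> W" "y' - x \<in> U" using * by blast
    have "(y - x) - (y' - x) \<in> U" using y y' subgroup_U by (blast intro: add_subgroup_diff)
    then have "y - y' \<in> S \<inter> U" using y y' assms(1) by (auto intro: add_subgroup_diff)
    then show "y - x \<in> W" using assms(2) y' by auto
  qed
  then show "x \<in> S" using y by simp
qed

lemma strongly_top_quasihamiltonian_discrete:
  assumes "add_subgroup G" "G \<inter> U = {0}" shows "strongly_top_quasihamiltonian G"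
  unfolding strongly_top_quasihamiltonian_iff
proof (intro allI impI)
  fix X Y assume XY: "X \<subseteq> G \<and> closed_subgroup X \<and> Y \<subseteq> G \<and> closed_subgroup Y"
  have s: "add_subgroup (set_sum X Y)"
    using XY by (auto simp: closed_subgroup_def intro: add_subgroup_set_sum)
  moreover have "set_sum X Y \<subseteq> G" using XY assms(1) by (intro set_sum_subset) auto
  then have "set_sum X Y \<inter> U = {0}"
    using assms(2) add_subgroup_0[OF s] add_subgroup_0[OF subgroup_U] by blast
  ultimately show "closed (set_sum X Y)" by (rule closed_if_Int_open_trivial)
qed

lemma strongly_top_quasihamiltonian_subset_compact:
  assumes "G \<subseteq> U" shows "strongly_top_quasihamiltonian G"
  unfolding strongly_top_quasihamiltonian_iff
proof (intro allI impI)
  fix X Y assume XY: "X \<subseteq> G \<and> closed_subgroup X \<and> Y \<subseteq> G \<and> closed_subgroup Y"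
  then have "X = U \<inter> X" "Y = U \<inter> Y" using assms by auto
  then have "compact X" "compact Y"
    using XY compact_U by (metis closed_subgroup_def compact_Int_closed)+
  then show "closed (set_sum X Y)" by (intro compact_imp_closed compact_set_sum)
qed

text \<open>Projections preserve \<open>X\<close> and \<open>Y\<close>, so \<open>X + Y\<close>
  splits into sums taken within each part; closed sets over disjoint sets of primes then recombine
  by \<open>closed_set_sum_disjoint\<close>.\<close>

lemma strongly_top_quasihamiltonian_Un:
  assumes \<sigma>: "strongly_top_quasihamiltonian (sigma_elements \<sigma>)"
    and \<tau>: "strongly_top_quasihamiltonian (sigma_elements \<tau>)" and dj: "\<sigma> \<inter> \<tau> = {}"
  shows "strongly_top_quasihamiltonian (sigma_elements (\<sigma> \<union> \<tau>))"
  unfolding strongly_top_quasihamiltonian_iff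
proof (intro allI impI)
  fix X Y
  assume "X \<subseteq> sigma_elements (\<sigma> \<union> \<tau>) \<and> closed_subgroup X \<and> Y \<subseteq> sigma_elements (\<sigma> \<union> \<tau>) \<and> closed_subgroup Y"
  then have X: "X \<subseteq> sigma_elements (\<sigma> \<union> \<tau>)" "closed_subgroup X"
    and Y: "Y \<subseteq> sigma_elements (\<sigma> \<union> \<tau>)" "closed_subgroup Y" by blast+
  let ?S = "\<lambda>\<rho>. set_sum (X \<inter> sigma_elements \<rho>) (Y \<inter> sigma_elements \<rho>)"
  have sub: "add_subgroup (set_sum X Y)"
    using X Y by (auto simp: closed_subgroup_def intro: add_subgroup_set_sum)
  have "set_sum X Y = set_sum (?S \<sigma>) (?S \<tau>)"
  proof
    have "?S \<rho> \<subseteq> set_sum X Y" for \<rho> unfolding set_sum_def by blast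
    then show "set_sum (?S \<sigma>) (?S \<tau>) \<subseteq> set_sum X Y" by (simp add: set_sum_subset[OF sub])
  next
    show "set_sum X Y \<subseteq> set_sum (?S \<sigma>) (?S \<tau>)"
    proof
      fix z assume "z \<in> set_sum X Y"
      then obtain x y where xy: "z = x + y" "x \<in> X" "y \<in> Y" by (auto simp: set_sum_def)
      have "proj \<rho> x + proj \<rho> y \<in> ?S \<rho>" for \<rho>
        unfolding set_sum_def
        using proj_in_closed_subgroup[OF X(2) xy(2)] proj_in_closed_subgroup[OF Y(2) xy(3)]
          proj_in_sigma_elements by blast
      moreover have "z = (proj \<sigma> x + proj \<sigma> y) + (proj \<tau> x + proj \<tau> y)"
      proof -
        have "z \<in> sigma_elements (\<sigma> \<union> \<tau>)"
          using xy X Y by (auto intro!: add_subgroup_add add_subgroup_sigma_elements)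
        then have "z = proj \<sigma> z + proj \<tau> z" using proj_id proj_Un[OF dj] by metis
        then show ?thesis using xy(1) by (simp add: proj_add)
      qed
      ultimately show "z \<in> set_sum (?S \<sigma>) (?S \<tau>)" unfolding set_sum_def[of "?S \<sigma>"] by blast
    qed
  qed
  moreover have "closed (set_sum (?S \<sigma>) (?S \<tau>))"
  proof (rule closed_set_sum_disjoint[OF _ _ _ _ dj])
    show "closed (?S \<sigma>)" "closed (?S \<tau>)"
      using \<sigma> \<tau> X Y unfolding strongly_top_quasihamiltonian_iff
      by (simp_all add: closed_subgroup_Int closed_subgroup_sigma_elements)
    show "?S \<sigma> \<subseteq> sigma_elements \<sigma>" "?S \<tau> \<subseteq> sigma_elements \<tau>"
      by (intro set_sum_subset add_subgroup_sigma_elements Int_lower2)+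
  qed
  ultimately show "closed (set_sum X Y)" by simp
qed

lemma strongly_top_quasihamiltonian_finite:
  assumes "finite S" "\<And>p. p \<in> S \<Longrightarrow> strongly_top_quasihamiltonian (sigma_elements {p})"
  shows "strongly_top_quasihamiltonian (sigma_elements S)"
  using assms
proof (induction S)
  case empty
  have "sigma_elements {} \<subseteq> U"
    by (rule sigma_elements_subset_closed_subgroup) (auto intro: open_subgroup_closed_subgroup subgroup_U open_U)
  then show ?case by (rule strongly_top_quasihamiltonian_subset_compact)
next
  case (insert p S)
  then show ?case using strongly_top_quasihamiltonian_Un[of "{p}" S] by simp
qed

text \<open>For each \<open>p\<close> the \<open>p\<close>-parts of \<open>X\<close> and \<open>Y\<close> are comparable, so \<open>X + Y\<close> is the direct sum of
  the part of \<open>Y\<close> at the primes \<open>P\<close> where \<open>Y\<close> dominates and the part of \<open>X\<close> at the others.\<close>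

lemma strongly_top_quasihamiltonian_inductively_monothetic:
  assumes im: "inductively_monothetic (sigma_elements \<sigma>)"
  shows "strongly_top_quasihamiltonian (sigma_elements \<sigma>)"
  unfolding strongly_top_quasihamiltonian_iff
proof (intro allI impI)
  fix X Y
  assume "X \<subseteq> sigma_elements \<sigma> \<and> closed_subgroup X \<and> Y \<subseteq> sigma_elements \<sigma> \<and> closed_subgroup Y"
  then have X: "X \<subseteq> sigma_elements \<sigma>" "closed_subgroup X"
    and Y: "Y \<subseteq> sigma_elements \<sigma>" "closed_subgroup Y" by blast+
  define P where "P = {p \<in> \<sigma>. X \<inter> sigma_elements {p} \<subseteq> Y}"
  have P: "P \<subseteq> \<sigma>" "P \<inter> (\<sigma> - P) = {}" "P \<union> (\<sigma> - P) = \<sigma>" by (auto simp: P_def)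
  have projX: "proj P x \<in> Y" if "x \<in> X" for x
  proof (rule sigma_elements_mem_closed_subgroup[OF proj_in_sigma_elements Y(2)])
    fix p assume "p \<in> P"
    have "proj {p} (proj P x) \<in> X" by (intro proj_in_closed_subgroup X(2) that)
    then show "proj {p} (proj P x) \<in> Y"
      using \<open>p \<in> P\<close> proj_in_sigma_elements unfolding P_def by blast
  qed
  have projY: "proj (\<sigma> - P) y \<in> X" if "y \<in> Y" for y
  proof (rule sigma_elements_mem_closed_subgroup[OF proj_in_sigma_elements X(2)])
    fix p assume p: "p \<in> \<sigma> - P" "prime p"
    let ?y = "proj {p} (proj (\<sigma> - P) y)"
    \<comment> \<open>\<open>a\<close> witnesses that \<open>p\<close> is not in \<open>P\<close>.
      As \<open>?y\<close> is in \<open>Y\<close> and \<open>a\<close> is not, comparability can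
      only put \<open>?y\<close> into the group of \<open>a\<close>, hence into
      \<open>X\<close>.\<close>
    obtain a where a: "a \<in> X" "a \<in> sigma_elements {p}" "a \<notin> Y" using p unfolding P_def by blast
    have y: "?y \<in> Y" "?y \<in> sigma_elements {p}"
      by (intro proj_in_closed_subgroup Y(2) that) (rule proj_in_sigma_elements)
    have "inductively_monothetic (sigma_elements {p})"
      using im p(1) by (intro inductively_monothetic_subset[OF im] sigma_elements_mono) auto
    then have "?y \<in> top_generated {a} \<or> a \<in> top_generated {?y}"
      using a y unfolding inductively_monothetic_iff_chain[OF p(2)] divisibility_chain_def by blast
    moreover have "a \<notin> top_generated {?y}"
      using a y top_generated_minimal[OF Y(2), of "{?y}"] by blast
    ultimately show "?y \<in> X" using a top_generated_minimal[OF X(2), of "{a}"] by blast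
  qed
  have "set_sum X Y = set_sum (Y \<inter> sigma_elements P) (X \<inter> sigma_elements (\<sigma> - P))"
  proof
    show "set_sum (Y \<inter> sigma_elements P) (X \<inter> sigma_elements (\<sigma> - P)) \<subseteq> set_sum X Y"
      unfolding set_sum_def by (auto, metis add.commute)
    show "set_sum X Y \<subseteq> set_sum (Y \<inter> sigma_elements P) (X \<inter> sigma_elements (\<sigma> - P))"
    proof
      fix z assume "z \<in> set_sum X Y"
      then obtain x y where xy: "z = x + y" "x \<in> X" "y \<in> Y" by (auto simp: set_sum_def)
      have "z \<in> sigma_elements \<sigma>"
        using xy X Y by (auto intro!: add_subgroup_add add_subgroup_sigma_elements)
      then have "z = proj P z + proj (\<sigma> - P) z" using proj_id proj_Un[OF P(2)] P(3) by metis
      moreover have "proj P z \<in> Y \<inter> sigma_elements P"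
        using projX[OF xy(2)] proj_in_closed_subgroup[OF Y(2) xy(3)] Y(2) proj_in_sigma_elements xy(1)
        by (auto simp: proj_add closed_subgroup_def intro: add_subgroup_add add_subgroup_sigma_elements)
      moreover have "proj (\<sigma> - P) z \<in> X \<inter> sigma_elements (\<sigma> - P)"
        using projY[OF xy(3)] proj_in_closed_subgroup[OF X(2) xy(2)] X(2) proj_in_sigma_elements xy(1)
        by (auto simp: proj_add closed_subgroup_def intro: add_subgroup_add add_subgroup_sigma_elements)
      ultimately show "z \<in> set_sum (Y \<inter> sigma_elements P) (X \<inter> sigma_elements (\<sigma> - P))"
        unfolding set_sum_def by blast
    qed
  qed
  moreover have "closed (set_sum (Y \<inter> sigma_elements P) (X \<inter> sigma_elements (\<sigma> - P)))"
    using X(2) Y(2) closed_subgroup_sigma_elements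
    by (intro closed_set_sum_disjoint[OF _ _ _ _ P(2)]) (auto simp: closed_subgroup_def)
  ultimately show "closed (set_sum X Y)" by simp
qed

text \<open>The four projections form a continuous inverse of the sum map; by \<open>cover\<close>
  no prime outside the four sets contributes, so they add up to the identity.\<close>

lemma top_direct_sum4_sigma_elements:
  assumes dj: "\<alpha> \<inter> \<beta> = {}" "(\<alpha> \<union> \<beta>) \<inter> \<gamma> = {}" "(\<alpha> \<union> \<beta> \<union> \<gamma>) \<inter> \<delta> = {}"
    and cover: "\<And>p x. prime p \<Longrightarrow> p \<notin> \<alpha> \<union> \<beta> \<union> \<gamma> \<union> \<delta> \<Longrightarrow> x \<in> sigma_elements {p} \<Longrightarrow> x = 0"
  shows "top_direct_sum4 (UNIV :: 'a set) (sigma_elements \<alpha>) (sigma_elements \<beta>) (sigma_elements \<gamma>) (sigma_elements \<delta>)"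
proof -
  let ?f = "\<lambda>(b, c, d, e). b + c + d + e :: 'a"
  let ?g = "\<lambda>x. (proj \<alpha> x, proj \<beta> x, proj \<gamma> x, proj \<delta> x)"
  let ?P = "sigma_elements \<alpha> \<times> sigma_elements \<beta> \<times> sigma_elements \<gamma> \<times> sigma_elements \<delta>"
  have all: "x \<in> sigma_elements (\<alpha> \<union> \<beta> \<union> \<gamma> \<union> \<delta>)" for x
  proof (rule mem_closed_subgroup_if_proj[OF closed_subgroup_sigma_elements])
    fix p :: nat assume p: "prime p"
    show "proj {p} x \<in> sigma_elements (\<alpha> \<union> \<beta> \<union> \<gamma> \<union> \<delta>)"
    proof (cases "p \<in> \<alpha> \<union> \<beta> \<union> \<gamma> \<union> \<delta>")
      case True
      then show ?thesis
        using proj_in_sigma_elements[of "{p}" x] sigma_elements_mono[of "{p}" "\<alpha> \<union> \<beta> \<union> \<gamma> \<union> \<delta>"] by blast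
    next
      case False
      then have "proj {p} x = 0" using cover[OF p] proj_in_sigma_elements by blast
      then show ?thesis by (simp add: add_subgroup_0 add_subgroup_sigma_elements)
    qed
  qed
  have fg: "?f (?g x) = x" for x
    using proj_id[OF all, of x] proj_Un[OF dj(1), of x] proj_Un[OF dj(2), of x] proj_Un[OF dj(3), of x] by simp
  have gf: "?g (b + c + d + e) = (b, c, d, e)"
    if "b \<in> sigma_elements \<alpha>" "c \<in> sigma_elements \<beta>" "d \<in> sigma_elements \<gamma>" "e \<in> sigma_elements \<delta>" for b c d e
  proof -
    have "\<alpha> \<inter> \<beta> = {}" "\<alpha> \<inter> \<gamma> = {}" "\<alpha> \<inter> \<delta> = {}" "\<beta> \<inter> \<alpha> = {}" "\<beta> \<inter> \<gamma> = {}" "\<beta> \<inter> \<delta> = {}"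
      "\<gamma> \<inter> \<alpha> = {}" "\<gamma> \<inter> \<beta> = {}" "\<gamma> \<inter> \<delta> = {}" "\<delta> \<inter> \<alpha> = {}" "\<delta> \<inter> \<beta> = {}" "\<delta> \<inter> \<gamma> = {}"
      using dj by blast+
    then show ?thesis
      using that by (simp add: proj_add proj_id proj_eq_0[OF that(1)] proj_eq_0[OF that(2)]
        proj_eq_0[OF that(3)] proj_eq_0[OF that(4)])
  qed
  have "homeomorphic_maps (top_of_set ?P) (top_of_set UNIV) ?f ?g"
    unfolding homeomorphic_maps_def
  proof (intro conjI ballI)
    show "continuous_map (top_of_set ?P) (top_of_set UNIV) ?f"
      by (simp add: case_prod_beta) (intro continuous_intros)
    show "continuous_map (top_of_set UNIV) (top_of_set ?P) ?g"
      by (auto simp: continuous_map_in_subtopology proj_in_sigma_elements intro!: continuous_intros continuous_on_proj)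
  qed (use fg gf in auto)
  then show ?thesis
    unfolding top_direct_sum4_def
    by (intro conjI add_subgroup_sigma_elements homeomorphic_maps_imp_map)
qed

section \<open>Mixed primes of rank at least two\<close>

text \<open>The search starts at exponent \<open>n\<close> so that the exit multiple is still
  divisible by \<open>p^n\<close>, as the comparison in \<open>chain_if_Int_open_subset\<close>
  requires.\<close>

lemma ex_exit_multiple:
  assumes g: "g \<in> sigma_elements {p}" and n: "zmul (int (p ^ n)) g \<notin> U"
  obtains m where "m \<ge> n" "zmul (int (p ^ m)) g \<notin> U" "zmul (int (p ^ Suc m)) g \<in> U"
proof -
  obtain k where k: "zmul (int (p ^ k)) g \<in> U"
    using sigma_elements_primeE[OF g subgroup_U open_U] .
  let ?P = "\<lambda>j. zmul (int (p ^ (n + j))) g \<in> U"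
  have "?P k"
    by (rule add_subgroup_zmul_dvd[OF subgroup_U k]) (simp add: le_imp_power_dvd)
  then have P: "?P (LEAST j. ?P j)" by (rule LeastI)
  have "(LEAST j. ?P j) \<noteq> 0" using P n by (metis add_0_right)
  then obtain j where j: "(LEAST j. ?P j) = Suc j" by (metis not0_implies_Suc)
  then have "\<not> ?P j" using not_less_Least[of j ?P] by simp
  then show ?thesis using that[of "n + j"] P j by simp
qed

text \<open>Two elements outside \<open>U\<close> are compared by the power of \<open>p\<close> taking them into \<open>U\<close>: up to elements
  annihilated by \<open>p\<close>, which lie in \<open>U\<close>, a multiple of the one with the higher power agrees with the
  other.\<close>

lemma chain_if_Int_open_subset:
  assumes p: "prime p"
    and ntriv: "sigma_elements {p} \<inter> U \<noteq> {0}" and nsub: "\<not> sigma_elements {p} \<subseteq> U"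
    and V: "\<And>x. x \<in> sigma_elements {p} \<Longrightarrow> x \<notin> U \<Longrightarrow> zmul (int p) x \<in> U \<Longrightarrow>
      sigma_elements {p} \<inter> U \<subseteq> top_generated {zmul (int p) x}"
  shows "divisibility_chain (sigma_elements {p})"
proof -
  let ?A = "sigma_elements {p}"
  note sA = add_subgroup_sigma_elements[of "{p}"]
  have exit: "\<exists>m\<ge>n. zmul (int (p ^ m)) g \<in> ?A \<and> zmul (int (p ^ m)) g \<notin> U \<and> zmul (int (p ^ Suc m)) g \<in> U"
    if "g \<in> ?A" "zmul (int (p ^ n)) g \<notin> U" for g n
    using ex_exit_multiple[OF that] add_subgroup_zmul[OF sA that(1)] by metis
  have sub: "top_generated {zmul (int (p ^ n)) g} \<subseteq> top_generated {g}" for n g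
    by (intro top_generated_minimal closed_subgroup_top_generated)
       (simp add: add_subgroup_zmul add_subgroup_top_generated mem_top_generated_self)
  \<comment> \<open>\<open>V\<close> speaks of elements that enter \<open>U\<close> after one
    multiplication by \<open>p\<close>; passing to the exit multiple of \<open>g\<close> extends it
    to every \<open>g\<close> outside \<open>U\<close>.\<close>
  have V': "?A \<inter> U \<subseteq> top_generated {g}" if g: "g \<in> ?A" "g \<notin> U" for g
  proof -
    obtain m where "zmul (int (p ^ m)) g \<in> ?A" "zmul (int (p ^ m)) g \<notin> U" "zmul (int (p ^ Suc m)) g \<in> U"
      using exit[of g 0] g by auto
    then have "?A \<inter> U \<subseteq> top_generated {zmul (int p) (zmul (int (p ^ m)) g)}"
      by (intro V) (simp_all add: mult.commute)
    then have "?A \<inter> U \<subseteq> top_generated {zmul (int (p ^ Suc m)) g}"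
      by (simp add: mult.commute)
    then show ?thesis using sub by blast
  qed
  \<comment> \<open>Outside \<open>U\<close>, such a \<open>d\<close> would by \<open>V\<close>
    squeeze \<open>?A \<inter> U\<close> into the trivial group, against
    \<open>ntriv\<close>.\<close>
  have tors: "d \<in> U" if "d \<in> ?A" "zmul (int p) d = 0" for d
  proof (rule ccontr)
    assume "d \<notin> U"
    then have "?A \<inter> U \<subseteq> top_generated {0}"
      using V[OF that(1)] that(2) add_subgroup_0[OF subgroup_U] by simp
    also have "\<dots> = {0}" by (rule top_generated_closed_subgroup[OF closed_subgroup_trivial])
    finally show False using ntriv add_subgroup_0[OF sA] add_subgroup_0[OF subgroup_U] by blast
  qed
  \<comment> \<open>Induction on an exponent \<open>n\<close> that takes \<open>h\<close> into
    \<open>U\<close>. The last premise says that \<open>g\<close> does not enter \<open>U\<close>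
    before exponent \<open>n\<close>; it is void for \<open>n = 0\<close>.\<close>
  have level: "h \<in> top_generated {g}"
    if "g \<in> ?A" "h \<in> ?A" "g \<notin> U" "zmul (int (p ^ n)) h \<in> U"
      "\<And>k. n = Suc k \<Longrightarrow> zmul (int (p ^ k)) g \<notin> U" for n g h
    using that
  proof (induction n arbitrary: h)
    case 0
    then show ?case using V'[of g] by auto
  next
    case (Suc n)
    show ?case
    proof (cases "zmul (int (p ^ n)) h \<in> U")
      case True
      have "zmul (int (p ^ k)) g \<notin> U" if "n = Suc k" for k
      proof
        assume "zmul (int (p ^ k)) g \<in> U"
        then have "zmul (int (p ^ n)) g \<in> U"
          by (rule add_subgroup_zmul_dvd[OF subgroup_U]) (simp add: le_imp_power_dvd that)
        then show False using Suc.prems(5)[of n] by simp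
      qed
      then show ?thesis using Suc.IH[of h] Suc.prems True by blast
    next
      case False
      let ?b = "zmul (int (p ^ n)) h"
      have bA: "?b \<in> ?A" by (intro add_subgroup_zmul sA Suc.prems)
      have pb: "zmul (int p) ?b \<in> ?A \<inter> U"
        using Suc.prems(4) add_subgroup_zmul[OF sA bA] by simp
      obtain m where m: "m \<ge> n" "zmul (int (p ^ m)) g \<in> ?A" "zmul (int (p ^ m)) g \<notin> U" "zmul (int (p ^ Suc m)) g \<in> U"
        using exit[of g n] Suc.prems(1) Suc.prems(5)[of n] by blast
      \<comment> \<open>Chosen so that \<open>p^n g'\<close> is the exit multiple of
        \<open>g\<close>. Then \<open>p^(n+1) h = p^(n+1) d\<close> for some \<open>d\<close> in the
        group of \<open>g'\<close>, so \<open>p^n (h - d)\<close> is killed by \<open>p\<close> and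
        lies in \<open>U\<close>: the exponent has dropped by one.\<close>
      define g' where "g' = zmul (int (p ^ (m - n))) g"
      have g': "zmul (int (p ^ n)) g' = zmul (int (p ^ m)) g"
        using m(1) by (simp add: g'_def flip: power_add)
      have "zmul (int p) ?b \<in> top_generated {zmul (int p) (zmul (int (p ^ m)) g)}"
        using V[OF m(2,3)] m(4) pb by auto
      then have "zmul (int p) ?b \<in> zmul (int p) ` zmul (int (p ^ n)) ` top_generated {g'}"
        by (simp only: top_generated_zmul flip: g')
      then obtain d where d: "d \<in> top_generated {g'}" "zmul (int p) ?b = zmul (int p) (zmul (int (p ^ n)) d)"
        by blast
      have dg: "d \<in> top_generated {g}" using d(1) sub unfolding g'_def by blast
      then have dA: "d \<in> ?A"
        using top_generated_minimal[OF closed_subgroup_sigma_elements, of "{g}" "{p}"] Suc.prems(1) by blast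
      have hd: "h - d \<in> ?A" by (intro add_subgroup_diff sA Suc.prems dA)
      have "zmul (int (p ^ n)) (h - d) \<in> U"
      proof (rule tors)
        show "zmul (int (p ^ n)) (h - d) \<in> ?A" by (intro add_subgroup_zmul sA hd)
        show "zmul (int p) (zmul (int (p ^ n)) (h - d)) = 0"
          using d(2) by (simp only: zmul.scale_right_diff_distrib) simp
      qed
      moreover have "zmul (int (p ^ k)) g \<notin> U" if "n = Suc k" for k
      proof
        assume "zmul (int (p ^ k)) g \<in> U"
        then have "zmul (int (p ^ n)) g \<in> U"
          by (rule add_subgroup_zmul_dvd[OF subgroup_U]) (simp add: le_imp_power_dvd that)
        then show False using Suc.prems(5)[of n] by simp
      qed
      ultimately have "h - d \<in> top_generated {g}"
        using Suc.IH[of "h - d"] Suc.prems(1,3) hd by blast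
      then have "(h - d) + d \<in> top_generated {g}"
        using dg by (intro add_subgroup_add add_subgroup_top_generated)
      then show ?thesis by simp
    qed
  qed
  show ?thesis
    unfolding divisibility_chain_def
  proof (intro ballI)
    fix g h assume gh: "g \<in> ?A" "h \<in> ?A"
    have *: "b \<in> top_generated {a}"
      if ab: "a \<in> ?A" "b \<in> ?A" "a \<notin> U" "b \<notin> U"
        and mn: "zmul (int (p ^ m)) a \<notin> U" "zmul (int (p ^ Suc n)) b \<in> U" "n \<le> m" for a b m n
    proof (rule level[OF ab(1,2,3) mn(2)])
      fix k assume "Suc n = Suc k"
      then show "zmul (int (p ^ k)) a \<notin> U"
        using mn(1,3) add_subgroup_zmul_dvd[OF subgroup_U, of "int (p ^ k)" a "int (p ^ m)"]
        by (auto simp: le_imp_power_dvd)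
    qed
    consider "g \<in> U" "h \<in> U" | "g \<notin> U" "h \<in> U" | "g \<in> U" "h \<notin> U" | "g \<notin> U" "h \<notin> U" by blast
    then show "g \<in> top_generated {h} \<or> h \<in> top_generated {g}"
    proof cases
      case 1
      \<comment> \<open>Two elements of \<open>U\<close> are compared inside the procyclic group of
        any element outside \<open>U\<close>, since that group contains
        \<open>?A \<inter> U\<close>.\<close>
      obtain x where x: "x \<in> ?A" "x \<notin> U" using nsub by blast
      then have "g \<in> top_generated {x}" "h \<in> top_generated {x}" using V'[OF x] 1 gh by blast+
      then show ?thesis by (rule procyclic_chain[OF x(1) p])
    next
      case 2
      then show ?thesis using V' gh by blast
    next
      case 3
      then show ?thesis using V' gh by blast
    next
      case 4
      obtain m where m: "zmul (int (p ^ m)) g \<notin> U" "zmul (int (p ^ Suc m)) g \<in> U"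
        using exit[of g 0] gh 4 by auto
      obtain n where n: "zmul (int (p ^ n)) h \<notin> U" "zmul (int (p ^ Suc n)) h \<in> U"
        using exit[of h 0] gh 4 by auto
      show ?thesis
      proof (cases "n \<le> m")
        case True
        then show ?thesis using *[OF gh 4 m(1) n(2)] by blast
      next
        case False
        then show ?thesis using *[OF gh(2,1) 4(2,1) n(1) m(2)] by simp
      qed
    qed
  qed
qed

text \<open>If no such pair existed, \<open>chain_if_Int_open_subset\<close> would make the
  component inductively monothetic.\<close>

lemma ex_bad_pair:
  assumes "prime p" "sigma_elements {p} \<inter> U \<noteq> {0}" "\<not> sigma_elements {p} \<subseteq> U"
    and "\<not> inductively_monothetic (sigma_elements {p})"
  shows "\<exists>x v. x \<in> sigma_elements {p} \<and> x \<notin> U \<and> zmul (int p) x \<in> U \<and>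
    v \<in> sigma_elements {p} \<and> v \<in> U \<and> v \<notin> top_generated {zmul (int p) x}"
  using chain_if_Int_open_subset[OF assms(1-3)] assms(4) inductively_monothetic_iff_chain[OF assms(1)] by blast

text \<open>An element outside the group of \<open>p x\<close> generates \<open>x\<close>, so if it
  were in \<open>U\<close> it would drag \<open>x\<close> into \<open>U\<close>.\<close>

lemma procyclic_Int_open:
  assumes "x \<in> sigma_elements {p}" "prime p" "x \<notin> U"
  shows "top_generated {x} \<inter> U \<subseteq> top_generated {zmul (int p) x}"
proof
  fix h assume h: "h \<in> top_generated {x} \<inter> U"
  show "h \<in> top_generated {zmul (int p) x}"
  proof (rule ccontr)
    assume "h \<notin> top_generated {zmul (int p) x}"
    then have "x \<in> top_generated {h}" using procyclic_generator[OF assms(1,2)] h by blast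
    moreover have "top_generated {h} \<subseteq> U"
      using h by (intro top_generated_minimal open_subgroup_closed_subgroup subgroup_U open_U) auto
    ultimately show False using assms(3) by blast
  qed
qed

text \<open>Generators at other primes project to 0, so the preimage of the group of
  \<open>x p\<close> is a closed subgroup containing all generators.\<close>

lemma proj_top_generated_family:
  assumes x: "\<And>q. q \<in> S \<Longrightarrow> x q \<in> sigma_elements {q}" and a: "a \<in> top_generated (x ` S)" and p: "p \<in> S"
  shows "proj {p} a \<in> top_generated {x p}"
proof -
  have "proj {p} (x q) \<in> {0, x p}" if "q \<in> S" for q
    using proj_id[OF x[OF that]] proj_eq_0[OF x[OF that], of "{p}"] by (cases "q = p") auto
  then have "proj {p} (x q) \<in> top_generated {x p}" if "q \<in> S" for q
    using that add_subgroup_0[OF add_subgroup_top_generated] mem_top_generated_self by fastforce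
  then have "x ` S \<subseteq> proj {p} -` top_generated {x p}" by blast
  then have "top_generated (x ` S) \<subseteq> proj {p} -` top_generated {x p}"
    by (intro top_generated_minimal additive_vimage_closed_subgroup additive_proj
        continuous_on_proj closed_subgroup_top_generated)
  then show ?thesis using a by blast
qed

text \<open>The elements \<open>x p\<close> generate \<open>X\<close>, the elements \<open>x p + v p\<close> generate \<open>Y\<close>, and the element with
  \<open>p\<close>-components \<open>v p\<close> lies in the closure of \<open>X + Y\<close> but not in \<open>X + Y\<close>.\<close>

lemma finite_bad_primes:
  assumes stq: "strongly_top_quasihamiltonian (UNIV :: 'a set)"
    and S: "\<And>p. p \<in> S \<Longrightarrow> prime p"
    and x: "\<And>p. p \<in> S \<Longrightarrow> x p \<in> sigma_elements {p} \<and> x p \<notin> U \<and> zmul (int p) (x p) \<in> U"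
    and v: "\<And>p. p \<in> S \<Longrightarrow> v p \<in> sigma_elements {p} \<and> v p \<in> U \<and> v p \<notin> top_generated {zmul (int p) (x p)}"
  shows "finite S"
proof (rule ccontr)
  assume inf: "infinite S"
  \<comment> \<open>Chosen so that \<open>v p = - x p + y p\<close> lies in the sum although neither
    \<open>x p\<close> nor \<open>y p\<close> is in \<open>U\<close>.\<close>
  define y where "y p = x p + v p" for p
  let ?X = "top_generated (x ` S)" and ?Y = "top_generated (y ` S)"
  have y: "y p \<in> sigma_elements {p}" "y p \<notin> U" if "p \<in> S" for p
  proof -
    show "y p \<in> sigma_elements {p}"
      using x[OF that] v[OF that] unfolding y_def by (intro add_subgroup_add add_subgroup_sigma_elements) auto
    have "v p + x p \<notin> U"
      using x[OF that] v[OF that] add_subgroup_add_cancel_left[OF subgroup_U, of "v p" "x p"] by blast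
    then show "y p \<notin> U" by (simp add: y_def add.commute)
  qed
  have "closed (set_sum ?X ?Y)"
    using stq closed_subgroup_top_generated unfolding strongly_top_quasihamiltonian_iff by blast
  then have cl: "closed_subgroup (set_sum ?X ?Y)"
    by (simp add: closed_subgroup_def add_subgroup_set_sum add_subgroup_top_generated)
  \<comment> \<open>Closedness of the sum makes this compact, so all the \<open>v p\<close> become
    the components of one element \<open>z\<close> of the sum.\<close>
  let ?K = "U \<inter> set_sum ?X ?Y"
  have K: "closed_subgroup ?K" "compact ?K"
  proof -
    show "closed_subgroup ?K"
      by (intro closed_subgroup_Int open_subgroup_closed_subgroup subgroup_U open_U cl)
    show "compact ?K" using cl compact_U by (simp add: closed_subgroup_def compact_Int_closed)
  qed
  have "v p \<in> ?K \<inter> sigma_elements {p}" if p: "p \<in> S" for p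
  proof -
    have "- x p \<in> ?X" "y p \<in> ?Y"
      using p top_generated_superset[of "x ` S"] top_generated_superset[of "y ` S"]
        add_subgroup_minus[OF add_subgroup_top_generated, of "x p" "x ` S"] by blast+
    moreover have "v p = - x p + y p" by (simp add: y_def)
    ultimately have "v p \<in> set_sum ?X ?Y" unfolding set_sum_def by blast
    then show ?thesis using v[OF p] by blast
  qed
  then obtain z where z: "z \<in> ?K" "\<And>p. p \<in> S \<Longrightarrow> proj {p} z = v p"
    using ex_with_projections[OF K, of S v] by blast
  then obtain a b where ab: "z = a + b" "a \<in> ?X" "b \<in> ?Y" unfolding set_sum_def by blast
  have "finite ({p. prime p \<and> proj {p} a \<notin> U} \<union> {p. prime p \<and> proj {p} b \<notin> U})"
    using finite_proj_notin_open_subgroup[OF subgroup_U open_U] by blast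
  \<comment> \<open>Only finitely many components of \<open>a\<close> and \<open>b\<close> leave
    \<open>U\<close>, so the infinite set \<open>S\<close> has a prime at which both stay
    inside.\<close>
  then obtain p where p: "p \<in> S" "p \<notin> {p. prime p \<and> proj {p} a \<notin> U} \<union> {p. prime p \<and> proj {p} b \<notin> U}"
    using inf by (meson finite_subset subsetI)
  have pp: "prime p" using S[OF p(1)] .
  have xA: "x p \<in> sigma_elements {p}" "x p \<notin> U" and vA: "v p \<in> sigma_elements {p}"
    using x[OF p(1)] v[OF p(1)] by blast+
  let ?D = "top_generated {zmul (int p) (x p)}"
  have "proj {p} a \<in> top_generated {x p} \<inter> U"
    using proj_top_generated_family[of S x a p] x ab(2) p pp by blast
  then have a: "proj {p} a \<in> ?D" using procyclic_Int_open[OF xA(1) pp xA(2)] by blast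
  have "proj {p} b \<in> top_generated {y p} \<inter> U"
    using proj_top_generated_family[of S y b p] y ab(3) p pp by blast
  then have "proj {p} b \<in> top_generated {zmul (int p) (y p)}"
    using procyclic_Int_open[OF y(1)[OF p(1)] pp y(2)[OF p(1)]] by blast
  then obtain b' where b': "proj {p} b = zmul (int p) b'" "b' \<in> top_generated {y p}"
    unfolding top_generated_zmul by blast
  \<comment> \<open>Splits \<open>b'\<close> into a part from \<open>x p\<close> and a part from
    \<open>v p\<close>; after multiplication by \<open>p\<close> the latter lies in the group of
    \<open>p v\<close>, the form Nakayama needs.\<close>
  let ?XV = "set_sum (top_generated {x p}) (top_generated {v p})"
  have "closed_subgroup ?XV"
    by (intro compact_subgroup_closed compact_set_sum add_subgroup_set_sum add_subgroup_top_generated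
        compact_top_generated) auto
  moreover have "y p \<in> ?XV"
    unfolding y_def set_sum_def using mem_top_generated_self by blast
  ultimately have "b' \<in> ?XV" using b'(2) top_generated_minimal[of ?XV "{y p}"] by blast
  then obtain c d where cd: "b' = c + d" "c \<in> top_generated {x p}" "d \<in> top_generated {v p}"
    by (auto simp: set_sum_def)
  have "v p = proj {p} a + proj {p} b"
    using z(2)[OF p(1)] ab(1) by (simp add: proj_add)
  then have "v p = (proj {p} a + zmul (int p) c) + zmul (int p) d"
    using b'(1) cd(1) by (simp only: zmul.scale_right_distrib add.assoc)
  moreover have "proj {p} a + zmul (int p) c \<in> ?D"
    using a cd(2) by (intro add_subgroup_add add_subgroup_top_generated zmul_mem_top_generated_zmul)
  moreover have "zmul (int p) d \<in> top_generated {zmul (int p) (v p)}"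
    using cd(3) by (rule zmul_mem_top_generated_zmul)
  ultimately have "v p \<in> set_sum ?D (top_generated {zmul (int p) (v p)})"
    unfolding set_sum_def by blast
  then have "v p \<in> ?D" by (rule nakayama_procyclic[OF vA pp closed_subgroup_top_generated])
  then show False using v[OF p(1)] by blast
qed

lemma mem_prime_support_iff:
  "p \<in> prime_support (UNIV :: 'a set) \<longleftrightarrow> prime p \<and> sigma_elements {p} \<noteq> {0}"
  by (simp add: prime_support_def primary_component_eq cong: conj_cong)

end

section \<open>Assembling the equivalence\<close>

theorem theorem1p5:
  fixes U :: "'a::{topological_ab_group_add, t2_space} set"
  defines "A \<equiv> (UNIV :: 'a set)"
  assumes "periodic_lca_group A"
    and "add_subgroup U" and "open U" and "compact U"
  shows "strongly_top_quasihamiltonian A \<longleftrightarrow>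
    (\<exists>\<delta> \<gamma> \<phi> \<mu>.
       \<delta> \<union> \<gamma> \<union> \<phi> \<union> \<mu> = prime_support A \<and>
       \<delta> \<inter> \<gamma> = {} \<and> \<delta> \<inter> \<phi> = {} \<and> \<delta> \<inter> \<mu> = {} \<and> \<gamma> \<inter> \<phi> = {} \<and> \<gamma> \<inter> \<mu> = {} \<and> \<phi> \<inter> \<mu> = {} \<and>
       \<delta> = {p \<in> prime_support A. primary_component A p \<inter> U = {0}} \<and>
       discrete (primary_part A \<delta>) \<and>
       \<gamma> = {p \<in> prime_support A. primary_component A p \<subseteq> U} \<and>
       profinite_group (primary_part A \<gamma>) \<and>
       \<phi> = {p \<in> prime_support A - (\<delta> \<union> \<gamma>). top_rank (primary_component A p) \<ge> 2} \<and>
       finite \<phi> \<and>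
       (\<forall>p\<in>\<phi>. strongly_top_quasihamiltonian (primary_component A p)) \<and>
       inductively_monothetic (primary_part A \<mu>) \<and>
       top_direct_sum4 A (primary_part A \<delta>) (primary_part A \<gamma>)
         (primary_part A \<phi>) (primary_part A \<mu>))"
proof -
  interpret periodic_group U
  proof
    show "totally_disconnected (UNIV :: 'a set)"
      using assms(2) by (simp add: periodic_lca_group_def A_def)
    fix x :: 'a
    have "x \<in> \<Union>{K. K \<subseteq> A \<and> add_subgroup K \<and> compact K}"
      using assms(2) by (simp add: periodic_lca_group_def A_def)
    then show "\<exists>K. add_subgroup K \<and> compact K \<and> x \<in> K" by blast
  qed (use assms in auto)
  let ?\<pi> = "prime_support A"
  \<comment> \<open>The set equations leave no choice for the first three sets; the fourth is what
    remains of the support.\<close>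
  define \<delta>0 where "\<delta>0 = {p \<in> ?\<pi>. sigma_elements {p} \<inter> U = {0}}"
  define \<gamma>0 where "\<gamma>0 = {p \<in> ?\<pi>. sigma_elements {p} \<subseteq> U}"
  define \<phi>0 where "\<phi>0 = {p \<in> ?\<pi> - (\<delta>0 \<union> \<gamma>0). \<not> inductively_monothetic (sigma_elements {p})}"
  define \<mu>0 where "\<mu>0 = ?\<pi> - (\<delta>0 \<union> \<gamma>0 \<union> \<phi>0)"
  have \<pi>: "prime p" "sigma_elements {p} \<noteq> {0}" if "p \<in> ?\<pi>" for p
    using that by (simp_all add: A_def mem_prime_support_iff)
  have pc: "primary_component A p = sigma_elements {p}" if "p \<in> ?\<pi>" for p
    using \<pi>(1)[OF that] by (simp add: A_def primary_component_eq)
  have pp: "primary_part A \<sigma> = sigma_elements \<sigma>" if "\<sigma> \<subseteq> ?\<pi>" for \<sigma>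
    unfolding A_def using that \<pi>(1) by (intro primary_part_eq) blast
  have sub: "\<delta>0 \<subseteq> ?\<pi>" "\<gamma>0 \<subseteq> ?\<pi>" "\<phi>0 \<subseteq> ?\<pi>" "\<mu>0 \<subseteq> ?\<pi>"
    by (auto simp: \<delta>0_def \<gamma>0_def \<phi>0_def \<mu>0_def)
  \<comment> \<open>A prime in both sets would have a component equal to its trivial intersection
    with \<open>U\<close>, impossible in the support.\<close>
  have \<delta>\<gamma>: "\<delta>0 \<inter> \<gamma>0 = {}"
    using \<pi>(2) unfolding \<delta>0_def \<gamma>0_def by (auto simp: Int_absorb2)
  have eq\<delta>: "{p \<in> ?\<pi>. primary_component A p \<inter> U = {0}} = \<delta>0"
    unfolding \<delta>0_def using pc by auto
  have eq\<gamma>: "{p \<in> ?\<pi>. primary_component A p \<subseteq> U} = \<gamma>0"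
    unfolding \<gamma>0_def using pc by auto
  have eq\<phi>: "{p \<in> ?\<pi> - (\<delta>0 \<union> \<gamma>0). top_rank (primary_component A p) \<ge> 2} = \<phi>0"
    unfolding \<phi>0_def using pc by (auto simp: top_rank_ge_2_iff)
  have U: "closed_subgroup U" by (rule open_subgroup_closed_subgroup[OF subgroup_U open_U])
  have A\<delta>: "sigma_elements \<delta>0 \<inter> U = {0}"
    by (rule sigma_elements_Int_open_trivial) (simp add: \<delta>0_def)
  have A\<gamma>: "sigma_elements \<gamma>0 \<subseteq> U"
    by (rule sigma_elements_subset_closed_subgroup[OF U]) (simp add: \<gamma>0_def)
  show ?thesis
  proof
    assume stq: "strongly_top_quasihamiltonian A"
    have "profinite_group (sigma_elements \<gamma>0)"
      unfolding profinite_group_def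
    proof (intro conjI add_subgroup_sigma_elements)
      have "sigma_elements \<gamma>0 = U \<inter> sigma_elements \<gamma>0" using A\<gamma> by blast
      then show "compact (sigma_elements \<gamma>0)"
        using compact_U closed_subgroup_sigma_elements by (metis closed_subgroup_def compact_Int_closed)
      show "totally_disconnected (sigma_elements \<gamma>0)"
        unfolding totally_disconnected_def
      proof
        fix x assume x: "x \<in> sigma_elements \<gamma>0"
        have "connected_component_set (sigma_elements \<gamma>0) x \<subseteq> connected_component_set UNIV x"
          by (rule connected_component_mono) simp
        then show "connected_component_set (sigma_elements \<gamma>0) x = {x}"
          using totally_disconnected_UNIV x connected_component_refl[OF x] by (auto simp: totally_disconnected_def)
      qed
    qed
    moreover have "finite \<phi>0"
    proof -
      have "\<exists>x v. x \<in> sigma_elements {p} \<and> x \<notin> U \<and> zmul (int p) x \<in> U \<and>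
        v \<in> sigma_elements {p} \<and> v \<in> U \<and> v \<notin> top_generated {zmul (int p) x}" if "p \<in> \<phi>0" for p
        using that \<pi>(1)[of p] unfolding \<phi>0_def \<delta>0_def \<gamma>0_def by (intro ex_bad_pair) auto
      then obtain x v where xv: "\<And>p. p \<in> \<phi>0 \<Longrightarrow> x p \<in> sigma_elements {p} \<and> x p \<notin> U \<and> zmul (int p) (x p) \<in> U \<and>
        v p \<in> sigma_elements {p} \<and> v p \<in> U \<and> v p \<notin> top_generated {zmul (int p) (x p)}"
        by metis
      show ?thesis
        using stq \<pi>(1) sub(3) xv by (intro finite_bad_primes[of \<phi>0 x v]) (auto simp: A_def)
    qed
    moreover have "inductively_monothetic (sigma_elements \<mu>0)"
      by (rule inductively_monothetic_sigma_elements) (auto simp: \<mu>0_def \<phi>0_def)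
    moreover have "top_direct_sum4 A (sigma_elements \<delta>0) (sigma_elements \<gamma>0) (sigma_elements \<phi>0) (sigma_elements \<mu>0)"
      unfolding A_def
    proof (rule top_direct_sum4_sigma_elements)
      fix p and x :: 'a
      assume "prime p" "p \<notin> \<delta>0 \<union> \<gamma>0 \<union> \<phi>0 \<union> \<mu>0" "x \<in> sigma_elements {p}"
      then show "x = 0" using mem_prime_support_iff[of p] by (auto simp: \<mu>0_def A_def)
    qed (use \<delta>\<gamma> in \<open>auto simp: \<phi>0_def \<mu>0_def\<close>)
    moreover have "\<forall>p\<in>\<phi>0. strongly_top_quasihamiltonian (primary_component A p)"
      using stq strongly_top_quasihamiltonian_subset by (auto simp: A_def)
    moreover have "\<delta>0 \<union> \<gamma>0 \<union> \<phi>0 \<union> \<mu>0 = ?\<pi>" "\<delta>0 \<inter> \<phi>0 = {}" "\<delta>0 \<inter> \<mu>0 = {}" "\<gamma>0 \<inter> \<phi>0 = {}"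
      "\<gamma>0 \<inter> \<mu>0 = {}" "\<phi>0 \<inter> \<mu>0 = {}"
      using sub by (auto simp: \<phi>0_def \<mu>0_def)
    ultimately show "\<exists>\<delta> \<gamma> \<phi> \<mu>.
       \<delta> \<union> \<gamma> \<union> \<phi> \<union> \<mu> = prime_support A \<and>
       \<delta> \<inter> \<gamma> = {} \<and> \<delta> \<inter> \<phi> = {} \<and> \<delta> \<inter> \<mu> = {} \<and> \<gamma> \<inter> \<phi> = {} \<and> \<gamma> \<inter> \<mu> = {} \<and> \<phi> \<inter> \<mu> = {} \<and>
       \<delta> = {p \<in> prime_support A. primary_component A p \<inter> U = {0}} \<and>
       discrete (primary_part A \<delta>) \<and>
       \<gamma> = {p \<in> prime_support A. primary_component A p \<subseteq> U} \<and>
       profinite_group (primary_part A \<gamma>) \<and>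
       \<phi> = {p \<in> prime_support A - (\<delta> \<union> \<gamma>). top_rank (primary_component A p) \<ge> 2} \<and>
       finite \<phi> \<and>
       (\<forall>p\<in>\<phi>. strongly_top_quasihamiltonian (primary_component A p)) \<and>
       inductively_monothetic (primary_part A \<mu>) \<and>
       top_direct_sum4 A (primary_part A \<delta>) (primary_part A \<gamma>)
         (primary_part A \<phi>) (primary_part A \<mu>)"
      using \<delta>\<gamma> eq\<delta> eq\<gamma> eq\<phi> discrete_if_Int_open_trivial[OF add_subgroup_sigma_elements A\<delta>]
      by (intro exI[where x = \<delta>0] exI[where x = \<gamma>0] exI[where x = \<phi>0] exI[where x = \<mu>0])
         (simp only: pp[OF sub(1)] pp[OF sub(2)] pp[OF sub(3)] pp[OF sub(4)] simp_thms)
  next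
    assume "\<exists>\<delta> \<gamma> \<phi> \<mu>.
       \<delta> \<union> \<gamma> \<union> \<phi> \<union> \<mu> = prime_support A \<and>
       \<delta> \<inter> \<gamma> = {} \<and> \<delta> \<inter> \<phi> = {} \<and> \<delta> \<inter> \<mu> = {} \<and> \<gamma> \<inter> \<phi> = {} \<and> \<gamma> \<inter> \<mu> = {} \<and> \<phi> \<inter> \<mu> = {} \<and>
       \<delta> = {p \<in> prime_support A. primary_component A p \<inter> U = {0}} \<and>
       discrete (primary_part A \<delta>) \<and>
       \<gamma> = {p \<in> prime_support A. primary_component A p \<subseteq> U} \<and>
       profinite_group (primary_part A \<gamma>) \<and>
       \<phi> = {p \<in> prime_support A - (\<delta> \<union> \<gamma>). top_rank (primary_component A p) \<ge> 2} \<and>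
       finite \<phi> \<and>
       (\<forall>p\<in>\<phi>. strongly_top_quasihamiltonian (primary_component A p)) \<and>
       inductively_monothetic (primary_part A \<mu>) \<and>
       top_direct_sum4 A (primary_part A \<delta>) (primary_part A \<gamma>)
         (primary_part A \<phi>) (primary_part A \<mu>)"
    \<comment> \<open>The set equations identify the given \<delta> and \<gamma> with
      \<open>\<delta>0\<close> and \<open>\<gamma>0\<close>.\<close>
    then obtain \<phi> \<mu> where cover: "\<delta>0 \<union> \<gamma>0 \<union> \<phi> \<union> \<mu> = ?\<pi>"
      and dj: "\<delta>0 \<inter> \<phi> = {}" "\<delta>0 \<inter> \<mu> = {}" "\<gamma>0 \<inter> \<phi> = {}" "\<gamma>0 \<inter> \<mu> = {}" "\<phi> \<inter> \<mu> = {}"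
      and \<phi>: "finite \<phi>" "\<forall>p\<in>\<phi>. strongly_top_quasihamiltonian (primary_component A p)"
      and \<mu>: "inductively_monothetic (primary_part A \<mu>)"
      unfolding eq\<delta> eq\<gamma> by (elim exE conjE) (simp only:)
    have "\<phi> \<subseteq> ?\<pi>" "\<mu> \<subseteq> ?\<pi>" using cover by auto
    have "strongly_top_quasihamiltonian (sigma_elements \<delta>0)"
      by (rule strongly_top_quasihamiltonian_discrete[OF add_subgroup_sigma_elements A\<delta>])
    moreover have "strongly_top_quasihamiltonian (sigma_elements \<gamma>0)"
      by (rule strongly_top_quasihamiltonian_subset_compact[OF A\<gamma>])
    moreover have "strongly_top_quasihamiltonian (sigma_elements \<phi>)"
    proof (rule strongly_top_quasihamiltonian_finite[OF \<phi>(1)])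
      fix p assume "p \<in> \<phi>"
      then show "strongly_top_quasihamiltonian (sigma_elements {p})"
        using \<phi>(2) pc \<open>\<phi> \<subseteq> ?\<pi>\<close> by (metis subsetD)
    qed
    moreover have "strongly_top_quasihamiltonian (sigma_elements \<mu>)"
      using \<mu> pp[OF \<open>\<mu> \<subseteq> ?\<pi>\<close>] by (intro strongly_top_quasihamiltonian_inductively_monothetic) simp
    ultimately have "strongly_top_quasihamiltonian (sigma_elements (\<delta>0 \<union> \<gamma>0 \<union> \<phi> \<union> \<mu>))"
      using \<delta>\<gamma> dj by (intro strongly_top_quasihamiltonian_Un) blast+
    \<comment> \<open>Components at primes outside the support vanish, so the part at the support is
      the whole group.\<close>
    moreover have "A \<subseteq> sigma_elements ?\<pi>"
    proof
      fix x
      show "x \<in> sigma_elements ?\<pi>"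
      proof (rule mem_closed_subgroup_if_proj[OF closed_subgroup_sigma_elements])
        fix p :: nat assume p: "prime p"
        show "proj {p} x \<in> sigma_elements ?\<pi>"
        proof (cases "p \<in> ?\<pi>")
          case True
          then show ?thesis
            using proj_in_sigma_elements[of "{p}" x] sigma_elements_mono[of "{p}" ?\<pi>] by blast
        next
          case False
          then have "proj {p} x = 0"
            using p proj_in_sigma_elements[of "{p}" x] by (auto simp: A_def mem_prime_support_iff)
          then show ?thesis by (simp add: add_subgroup_0 add_subgroup_sigma_elements)
        qed
      qed
    qed
    ultimately show "strongly_top_quasihamiltonian A"
      unfolding cover by (rule strongly_top_quasihamiltonian_subset)
  qed
qed

end
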